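(* Let $T>0$, $\lambda>0$, $0<d<T$ and $0<\alpha_2\le\alpha_3\le 1$. Suppose bidders enter an auction on $[0,T]$ according to a homogeneous Poisson process of rate $\lambda$, and that each bidder, independently of the others, behaves as follows. His first potential bid time $s_1$ is his arrival time. At each potential bid time $s_k$ he either places his single bid (and makes no further bids) or, if he does not, selects $s_{k+1}\sim U(s_k,T)$ as his next potential bid time. The probability of placing the bid at a potential bid time is $\alpha_2$ if that time lies in $[0,T-d]$ and $\alpha_3$ if it lies in $(T-d,T]$. In addition, a bidder who has not placed his bid by time $T-d$ ultimately departs the auction without bidding with probability $1-\alpha_2/\alpha_3$. Let $\tau$ denote the bid time of a bidder chosen randomly from those who successfully place a bid, and let $$\pi=1-\Bigl(\frac{d}{T}\Bigr)^{\alpha_2}\Bigl(1-\frac{\alpha_2}{\alpha_3}\Bigr).$$ Then $\pi$ is the probability that a randomly chosen bidder successfully places a bid, $$P(\tau\le t)=\begin{cases}\dfrac{1}{\pi}\Bigl\{1-\Bigl(1-\dfrac{t}{T}\Bigr)^{\alpha_2}\Bigr\}, & 0\le t<T-d,\\[2mm] 1-\dfrac{1}{\pi}\,\dfrac{\alpha_2}{\alpha_3}\Bigl(\dfrac{d}{T}\Bigr)^{\alpha_2}\Bigl(\dfrac{T-t}{d}\Bigr)^{\alpha_3}, & T-d\le t\le T,\end{cases}$$ and the resulting process of bid arrivals is a nonhomogeneous Poisson process on $[0,T]$ with intensity function, for some constant $c>0$, $$\lambda(t)=\begin{cases} c\Bigl(1-\dfrac{t}{T}\Bigr)^{\alpha_2-1},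 & 0\le t<T-d,\\[2mm] c\Bigl(\dfrac{d}{T}\Bigr)^{\alpha_2-\alpha_3}\Bigl(1-\dfrac{t}{T}\Bigr)^{\alpha_3-1}, & T-d\le t<T.\end{cases}$$
   Context: $U(a,b)$ denotes the uniform distribution on $(a,b)$. All bid/no-bid decisions are independent of each other and of the potential bid times; given $s_k$, the time $s_{k+1}$ is uniform on $(s_k,T)$ independently of the earlier history. The departure rule means: for each bidder there is an independent event of probability $1-\alpha_2/\alpha_3$ on which, if he has not placed his bid at a potential bid time in $[0,T-d]$ (this includes bidders arriving after $T-d$), he never bids; off this event he continues with the stated rule on $(T-d,T]$. A "randomly chosen bidder" is a bidder whose arrival time is uniformly distributed on $[0,T]$ (the law of a typical arrival of a homogeneous Poisson process on $[0,T]$) and who follows the described rule; the law of $\tau$ is the law of such a bidder's bid time conditioned on his placing a bid. A nonhomogeneous Poisson process on $[0,T]$ with intensity function $\lambda(\cdot)$ is a counting process with independent increments such that the number of points in any interval $(u,v]$ is Poisson distributed with mean $\int_u^v\lambda(t)\,dt$. *)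

theory Defs
  imports "HOL-Probability.Probability"
begin

text \<open>
  \<open>N t\<close> is the number of points in \<open>[0, t]\<close>, so \<open>N v - N u\<close> is the number of points in
  \<open>(u, v]\<close>. Integrability of the intensity \<open>r\<close> is required explicitly because the Bochner integral of a
  non-integrable function is 0.
\<close>

definition poisson_process ::
    "'a measure \<Rightarrow> real \<Rightarrow> (real \<Rightarrow> real) \<Rightarrow> (real \<Rightarrow> 'a \<Rightarrow> nat) \<Rightarrow> bool" where
  "poisson_process M T r N \<longleftrightarrow>
     (\<forall>t\<in>{0..T}. 0 \<le> r t) \<and> set_integrable lborel {0..T} r \<and>
     (\<forall>t\<in>{0..T}. N t \<in> measurable M (count_space UNIV)) \<and>
     (AE \<omega> in M. N 0 \<omega> = 0) \<and>
     (\<forall>\<omega>\<in>space M. mono_on {0..T} (\<lambda>t. N t \<omega>)) \<and>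
     (\<forall>\<omega>\<in>space M. \<forall>t\<in>{0..<T}. \<forall>\<^sub>F s in at_right t. N s \<omega> = N t \<omega>) \<and>
     (\<forall>(t :: nat \<Rightarrow> real) n. 0 \<le> t 0 \<longrightarrow> (\<forall>k<n. t k \<le> t (Suc k)) \<longrightarrow> t n \<le> T \<longrightarrow>
        prob_space.indep_vars M (\<lambda>_. count_space UNIV)
          (\<lambda>k \<omega>. N (t (Suc k)) \<omega> - N (t k) \<omega>) {..<n}) \<and>
     (\<forall>u v n. 0 \<le> u \<longrightarrow> u \<le> v \<longrightarrow> v \<le> T \<longrightarrow>
        measure M {\<omega> \<in> space M. N v \<omega> - N u \<omega> = n} =
          (LINT s:{u<..v}|lborel. r s) ^ n / fact n * exp (- (LINT s:{u<..v}|lborel. r s)))"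

definition generated_by :: "'a measure \<Rightarrow> ('a \<Rightarrow> real) set \<Rightarrow> 'a set set \<Rightarrow> 'a measure" where
  "generated_by M \<X> \<E> =
     sigma (space M) ({X -` C \<inter> space M | X C. X \<in> \<X> \<and> C \<in> sets borel} \<union> \<E>)"

text \<open>
  Behaviour of one bidder. \<open>S k\<close> is the potential bid time called \<open>s\<close> with index \<open>k + 1\<close> in
  the usual numbering (so \<open>S 0\<close> is the arrival time), \<open>B k\<close> is the event that the bid/no-bid
  decision at \<open>S k\<close> is to bid, and \<open>D\<close> is the event that the bidder departs if he has not bid
  by time \<open>T - d\<close>. The sets \<open>\<X>\<close> and \<open>\<E>\<close> collect the outside random variables and events
  (arrivals and other bidders) of which the bidder's choices are independent, and \<open>G\<close> is the
  event that the bidder exists. The conditional laws are imposed only as long as no decision to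
  bid has been taken; the values of \<open>S\<close> and \<open>B\<close> after the first decision to bid are never used.
\<close>

definition follows_bid_rule ::
    "real \<Rightarrow> real \<Rightarrow> real \<Rightarrow> real \<Rightarrow> 'a measure \<Rightarrow> 'a set \<Rightarrow> ('a \<Rightarrow> real) set \<Rightarrow> 'a set set \<Rightarrow>
     (nat \<Rightarrow> 'a \<Rightarrow> real) \<Rightarrow> (nat \<Rightarrow> 'a set) \<Rightarrow> 'a set \<Rightarrow> bool" where
  "follows_bid_rule T d \<alpha>\<^sub>2 \<alpha>\<^sub>3 M G \<X> \<E> S B D \<longleftrightarrow>
     (\<forall>k. S k \<in> borel_measurable M) \<and> (\<forall>k. B k \<in> sets M) \<and> D \<in> sets M \<and>
     (AE \<omega> in M. \<omega> \<in> G \<longrightarrow>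
        real_cond_exp M (generated_by M (\<X> \<union> {S 0}) \<E>) (indicator D) \<omega> = 1 - \<alpha>\<^sub>2 / \<alpha>\<^sub>3) \<and>
     (\<forall>k. AE \<omega> in M. \<omega> \<in> G - (\<Union>j<k. B j) \<longrightarrow>
        real_cond_exp M (generated_by M (\<X> \<union> S ` {..k}) (\<E> \<union> {D} \<union> B ` {..<k}))
          (indicator (B k)) \<omega> = (if S k \<omega> \<le> T - d then \<alpha>\<^sub>2 else \<alpha>\<^sub>3)) \<and>
     (\<forall>k. \<forall>C\<in>sets borel. AE \<omega> in M. \<omega> \<in> G - (\<Union>j\<le>k. B j) \<longrightarrow>
        real_cond_exp M (generated_by M (\<X> \<union> S ` {..k}) (\<E> \<union> {D} \<union> B ` {..k}))
          (indicator (S (Suc k) -` C \<inter> space M)) \<omega> =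
        measure (uniform_measure lborel {S k \<omega><..<T}) C)"

definition bid_time :: "(nat \<Rightarrow> 'a \<Rightarrow> real) \<Rightarrow> (nat \<Rightarrow> 'a set) \<Rightarrow> 'a \<Rightarrow> real" where
  "bid_time S B \<omega> = S (LEAST k. \<omega> \<in> B k) \<omega>"

definition places_bid ::
    "real \<Rightarrow> real \<Rightarrow> (nat \<Rightarrow> 'a \<Rightarrow> real) \<Rightarrow> (nat \<Rightarrow> 'a set) \<Rightarrow> 'a set \<Rightarrow> 'a \<Rightarrow> bool" where
  "places_bid T d S B D \<omega> \<longleftrightarrow>
     (\<exists>k. \<omega> \<in> B k) \<and> (bid_time S B \<omega> \<le> T - d \<or> \<omega> \<notin> D)"

definition random_bidder ::
    "real \<Rightarrow> real \<Rightarrow> real \<Rightarrow> real \<Rightarrow> 'a measure \<Rightarrow>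
     (nat \<Rightarrow> 'a \<Rightarrow> real) \<Rightarrow> (nat \<Rightarrow> 'a set) \<Rightarrow> 'a set \<Rightarrow> bool" where
  "random_bidder T d \<alpha>\<^sub>2 \<alpha>\<^sub>3 M S B D \<longleftrightarrow>
     prob_space M \<and> distr M lborel (S 0) = uniform_measure lborel {0..T} \<and>
     follows_bid_rule T d \<alpha>\<^sub>2 \<alpha>\<^sub>3 M (space M) {} {} S B D"

text \<open>
  \<open>K\<close> is the number of bidders arriving in \<open>[0, T]\<close>; they carry the labels \<open>i < K\<close> (not
  necessarily in order of arrival), and \<open>S i\<close>, \<open>B i\<close>, \<open>D i\<close> describe bidder \<open>i\<close>. Where
  \<open>K \<le> i\<close>, the values of \<open>S i\<close>, \<open>B i\<close>, \<open>D i\<close> are placeholders (for instance constants): no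
  law is imposed on them, but they belong to the outside information of the other bidders.
\<close>

definition auction ::
    "real \<Rightarrow> real \<Rightarrow> real \<Rightarrow> real \<Rightarrow> real \<Rightarrow> 'a measure \<Rightarrow> ('a \<Rightarrow> nat) \<Rightarrow>
     (nat \<Rightarrow> nat \<Rightarrow> 'a \<Rightarrow> real) \<Rightarrow> (nat \<Rightarrow> nat \<Rightarrow> 'a set) \<Rightarrow> (nat \<Rightarrow> 'a set) \<Rightarrow> bool" where
  "auction T rate d \<alpha>\<^sub>2 \<alpha>\<^sub>3 M K S B D \<longleftrightarrow>
     prob_space M \<and> K \<in> measurable M (count_space UNIV) \<and>
     (\<forall>\<omega>\<in>space M. \<forall>i<K \<omega>. S i 0 \<omega> \<in> {0..T}) \<and>
     poisson_process M T (\<lambda>_. rate) (\<lambda>t \<omega>. card {i. i < K \<omega> \<and> S i 0 \<omega> \<le> t}) \<and>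
     (\<forall>i. follows_bid_rule T d \<alpha>\<^sub>2 \<alpha>\<^sub>3 M {\<omega> \<in> space M. i < K \<omega>}
        (range (\<lambda>j. S j 0) \<union> {S j k | j k. j \<noteq> i})
        (range (\<lambda>n. {\<omega> \<in> space M. K \<omega> = n}) \<union> {B j k | j k. j \<noteq> i} \<union> {D j | j. j \<noteq> i})
        (S i) (B i) (D i))"

end

theory Submission
  imports Defs
begin

text \<open>
  The potential bid times of a bidder who never bids form, after his arrival, a Poisson process of
  intensity \<open>1 / (T - x)\<close>, so thinning by the bid probability \<open>a x\<close> gives the bid time the hazard
  rate \<open>a x / (T - x)\<close>, departures being left aside. With \<open>R\<close> the solution of
  \<open>R' = - a x / (T - x) * R\<close>, \<open>R 0 = 1\<close>, a bidder who does not bid at \<open>x\<close> bids after \<open>t \<ge> x\<close> with probability \<open>R t / R x\<close>; this is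
  confirmed by conditioning on the next potential bid time. Averaging over a uniform arrival time
  leaves \<open>R t\<close>, because \<open>(T - x) / R x\<close> is a primitive of \<open>- (1 - a x) / R x\<close>.

  For the auction, the probability generating functional
  \<open>E (\<Prod>i<K. g (A i)) = exp (- rate * \<integral> (1 - g))\<close> of the arrivals, applied to the conditional mean of
  \<open>\<Prod>k. z k ^ (number of bids of bidder i in the k-th interval)\<close>, shows that the joint
  generating function of the numbers of bids in disjoint intervals is a product of Poisson
  generating functions.
\<close>

subsection \<open>The bid time of a single bidder as a function of the arrival time\<close>

text \<open>The rule is given only through conditional probabilities with respect to growing
  sigma-algebras, and only while the bidder exists and has not decided to bid. Every identity is
  therefore an expectation with a bounded test factor \<open>Z\<close> that is determined by the
  conditioning information and vanishes where the rule is silent. \<open>Z\<close> also carries the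
  arrivals and the other bidders; this is how independence between bidders enters.

  Departure is a mixture: given the arrival, \<open>D\<close> has probability
  \<open>1 - \<alpha>\<^sub>2 / \<alpha>\<^sub>3\<close>, the decisions go on regardless of it, and
  \<open>D\<close> only cancels a bid after \<open>T - d\<close>. Late bids are thus thinned by
  \<open>\<alpha>\<^sub>2 / \<alpha>\<^sub>3\<close>, which turns their hazard factor
  \<open>\<alpha>\<^sub>3\<close> into \<open>\<alpha>\<^sub>2\<close>. Hence one constant
  \<open>c = rate * \<alpha>\<^sub>2\<close> serves both branches, and the intensity is continuous
  at \<open>T - d\<close>.

  As a function of the arrival time, the probability of having bid by \<open>t\<close> can jump at
  \<open>t\<close> and at \<open>T - d\<close>. It is continuous from the left everywhere, which
  suffices for Riemann sums at left end points.\<close>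

locale bidding =
  fixes T d \<alpha>\<^sub>2 \<alpha>\<^sub>3 :: real
  assumes T_pos: "0 < T" and d_pos: "0 < d" and d_less: "d < T"
    and \<alpha>\<^sub>2_pos: "0 < \<alpha>\<^sub>2" and \<alpha>\<^sub>2_le: "\<alpha>\<^sub>2 \<le> \<alpha>\<^sub>3" and \<alpha>\<^sub>3_le: "\<alpha>\<^sub>3 \<le> 1"
begin

definition bid_prob :: "real \<Rightarrow> real" where
  "bid_prob x = (if x \<le> T - d then \<alpha>\<^sub>2 else \<alpha>\<^sub>3)"

text \<open>The function \<open>R\<close> for the hazard rate \<open>bid_prob x / (T - x)\<close>,
  solved on either side of \<open>T - d\<close>. The factor
  \<open>(d / T) powr \<alpha>\<^sub>2\<close> is the value reached at \<open>T - d\<close>, so that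
  the two branches fit together.\<close>

definition surv :: "real \<Rightarrow> real" where
  "surv x = (if x \<le> T - d then ((T - x) / T) powr \<alpha>\<^sub>2
             else (d / T) powr \<alpha>\<^sub>2 * ((T - x) / d) powr \<alpha>\<^sub>3)"

text \<open>
  The probabilities, departures being left aside, of bidding after \<open>t\<close> given a decision not to bid
  at \<open>x\<close> (\<open>surv_after\<close>) and given an undecided potential bid time \<open>x\<close> (\<open>surv_at\<close>).
\<close>

definition surv_after :: "real \<Rightarrow> real \<Rightarrow> real" where
  "surv_after t x = (if x \<le> t then surv t / surv x else 1)"

definition surv_at :: "real \<Rightarrow> real \<Rightarrow> real" where
  "surv_at t x = bid_prob x * (if t < x then 1 else 0) + (1 - bid_prob x) * surv_after t x"

lemma bid_prob_bounds: "\<alpha>\<^sub>2 \<le> bid_prob x" "0 < bid_prob x" "bid_prob x \<le> 1"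
  using \<alpha>\<^sub>2_pos \<alpha>\<^sub>2_le \<alpha>\<^sub>3_le by (auto simp: bid_prob_def)

lemma bid_prob_measurable [measurable]: "bid_prob \<in> borel_measurable borel"
  unfolding bid_prob_def by measurable

lemma surv_nonneg: "0 \<le> surv x"
  by (simp add: surv_def)

lemma surv_pos: "x < T \<Longrightarrow> 0 < surv x"
  using T_pos d_pos d_less by (auto simp: surv_def)

lemma surv_0 [simp]: "surv 0 = 1"
  using T_pos d_pos d_less by (simp add: surv_def)

lemma surv_T [simp]: "surv T = 0"
  using d_pos by (simp add: surv_def)

lemma surv_antimono:
  assumes "x \<le> y" "y \<le> T"
  shows "surv y \<le> surv x"
proof -
  have early: "surv y \<le> surv x" if "x \<le> y" "y \<le> T - d" for x y
    using that T_pos d_pos \<alpha>\<^sub>2_pos by (auto simp: surv_def intro!: powr_mono2 divide_right_mono)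
  have late: "surv y \<le> (d / T) powr \<alpha>\<^sub>2 * ((T - x) / d) powr \<alpha>\<^sub>3"
    if "x \<le> y" "T - d \<le> x" "T - d < y" "y \<le> T" for x y
    using that T_pos d_pos \<alpha>\<^sub>2_pos \<alpha>\<^sub>2_le
    by (auto simp: surv_def intro!: mult_left_mono powr_mono2 divide_right_mono)
  show ?thesis
  proof (cases "y \<le> T - d")
    case True
    then show ?thesis using early assms by blast
  next
    case y: False
    show ?thesis
    proof (cases "x \<le> T - d")
      case True
      have "surv y \<le> surv (T - d)"
        using late[of "T - d" y] y assms d_pos by (simp add: surv_def)
      also have "\<dots> \<le> surv x" using early True by simp
      finally show ?thesis .
    next
      case False
      then show ?thesis using late[of x y] y assms by (simp add: surv_def)
    qed
  qed
qed

lemma continuous_on_surv: "continuous_on {..T} surv"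
proof -
  have "continuous_on ({..T - d} \<union> {T - d..T}) (\<lambda>x. if x \<le> T - d then ((T - x) / T) powr \<alpha>\<^sub>2
             else (d / T) powr \<alpha>\<^sub>2 * ((T - x) / d) powr \<alpha>\<^sub>3)"
    using T_pos d_pos \<alpha>\<^sub>2_pos \<alpha>\<^sub>2_le
    by (intro continuous_on_cases continuous_intros continuous_on_powr') auto
  moreover have "{..T - d} \<union> {T - d..T} = {..T}" using d_pos by auto
  ultimately show ?thesis unfolding surv_def[abs_def] by simp
qed

lemma surv_measurable [measurable]: "surv \<in> borel_measurable borel"
  unfolding surv_def[abs_def] by measurable

lemma surv_after_measurable [measurable]: "surv_after t \<in> borel_measurable borel"
  unfolding surv_after_def[abs_def] by measurable

lemma surv_at_measurable [measurable]: "surv_at t \<in> borel_measurable borel"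
  unfolding surv_at_def[abs_def] by measurable

lemma surv_after_bounds:
  assumes "t \<le> T"
  shows "0 \<le> surv_after t x" "surv_after t x \<le> 1"
proof -
  show "0 \<le> surv_after t x" by (simp add: surv_after_def surv_nonneg)
  show "surv_after t x \<le> 1"
    using surv_antimono[of x t] surv_nonneg[of x] assms
    by (auto simp: surv_after_def divide_le_eq)
qed

lemma surv_at_bounds:
  assumes "t \<le> T"
  shows "0 \<le> surv_at t x" "surv_at t x \<le> 1"
proof -
  note b = bid_prob_bounds[of x] surv_after_bounds[OF assms, of x]
  show "0 \<le> surv_at t x" using b by (simp add: surv_at_def)
  show "surv_at t x \<le> 1"
    using b convex_bound_le[of "if t < x then 1 else 0" "1" "surv_after t x" "bid_prob x" "1 - bid_prob x"]
    by (auto simp: surv_at_def)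
qed

lemma surv_at_beyond: "t < x \<Longrightarrow> surv_at t x = 1"
  by (simp add: surv_at_def surv_after_def)

lemma surv_at_mono:
  assumes "s \<le> t" "t \<le> T"
  shows "surv_at t x \<le> surv_at s x"
proof -
  have "surv_after t x \<le> surv_after s x"
    using assms surv_antimono[of s t] surv_nonneg surv_after_bounds(2)[of t x]
    by (auto simp: surv_after_def divide_right_mono)
  then show ?thesis
    unfolding surv_at_def using bid_prob_bounds[of x] assms
    by (intro add_mono mult_left_mono) auto
qed

text \<open>The point \<open>T - d\<close> is left out because the hazard jumps there from
  \<open>\<alpha>\<^sub>2\<close> to \<open>\<alpha>\<^sub>3\<close>. The derivative is only
  integrated later on, where a finite exceptional set is harmless.\<close>

lemma surv_derivative:
  assumes "x < T" "x \<noteq> T - d"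
  shows "(surv has_real_derivative - (bid_prob x / (T - x)) * surv x) (at x)"
proof (cases "x < T - d")
  case True
  have "((\<lambda>x. ((T - x) / T) powr \<alpha>\<^sub>2) has_real_derivative - (bid_prob x / (T - x)) * surv x) (at x)"
    using True assms T_pos
    by (auto intro!: derivative_eq_intros simp: bid_prob_def surv_def powr_diff field_simps)
  then show ?thesis
    by (rule DERIV_cong_ev[OF refl _ refl, THEN iffD1, rotated])
      (use True in \<open>auto simp: surv_def eventually_nhds intro!: exI[of _ "{..<T - d}"]\<close>)
next
  case False
  have "((\<lambda>x. (d / T) powr \<alpha>\<^sub>2 * ((T - x) / d) powr \<alpha>\<^sub>3) has_real_derivative
      - (bid_prob x / (T - x)) * surv x) (at x)"
    using False assms d_pos
    by (auto intro!: derivative_eq_intros simp: bid_prob_def surv_def powr_diff field_simps)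
  then show ?thesis
    by (rule DERIV_cong_ev[OF refl _ refl, THEN iffD1, rotated])
      (use False assms in \<open>auto simp: surv_def eventually_nhds intro!: exI[of _ "{T - d<..}"]\<close>)
qed

text \<open>Up to \<open>t\<close> the integrand has the primitive \<open>F\<close>, after
  \<open>t\<close> it is 1. Divided by \<open>T - x\<close>, the result is the fixed point equation
  that confirms the guess: averaging over the next potential bid time after a decision not to bid at
  \<open>x\<close> reproduces \<open>surv_after t x\<close>.\<close>

lemma surv_at_has_integral:
  assumes "x < T" "t \<le> T"
  shows "(surv_at t has_integral (T - x) * surv_after t x) {x..T}"
proof -
  have one: "(surv_at t has_integral (T - y)) {y..T}" if "t \<le> y" "y \<le> T" for y
  \<comment> \<open>Only at \<open>y = t\<close> can the value differ from 1, because a bid exactly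
    at \<open>t\<close> does not count as later.\<close>
  proof (rule has_integral_spike_finite[of "{t}"])
    show "((\<lambda>_. 1) has_integral (T - y)) {y..T}"
      using has_integral_const_real[of "1::real" y T] that by simp
  qed (use that in \<open>auto simp: surv_at_beyond\<close>)
  consider "t \<le> x" "t < x" | "t = T" | "x \<le> t" "t < T" using assms by linarith
  then show ?thesis
  proof cases
    case 1
    then show ?thesis using one[of x] assms by (simp add: surv_after_def)
  next
    \<comment> \<open>This case is separate because \<open>surv T = 0\<close> would make
      \<open>F\<close> divide by zero; here the integrand vanishes on the whole interval.\<close>
    case 2
    have "((\<lambda>_. 0) has_integral 0) {x..T}" by simp
    then have "(surv_at t has_integral 0) {x..T}"
      by (rule has_integral_eq[rotated]) (use 2 in \<open>auto simp: surv_at_def surv_after_def\<close>)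
    then show ?thesis using 2 assms by (simp add: surv_after_def)
  next
    case 3
    define F where "F y = - ((T - y) * surv t / surv y)" for y
    have pos: "surv y \<noteq> 0" if "y \<le> t" for y using surv_pos[of y] that 3 by simp
    have "(surv_at t has_integral F t - F x) {x..t}"
    proof (rule fundamental_theorem_of_calculus_interior_strong[of "{T - d}"])
      show "(F has_vector_derivative surv_at t y) (at y)" if "y \<in> {x<..<t} - {T - d}" for y
      proof -
        have y: "y < T" "y \<noteq> T - d" "surv y \<noteq> 0" using that 3 pos by auto
        have "(F has_real_derivative surv_at t y) (at y)"
          unfolding F_def
          by (rule derivative_eq_intros surv_derivative y refl)+
            (use y that in \<open>simp add: surv_at_def surv_after_def field_simps\<close>)
        then show ?thesis by (simp add: has_real_derivative_iff_has_vector_derivative)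
      qed
      have "continuous_on {x..t} surv"
        by (rule continuous_on_subset[OF continuous_on_surv]) (use 3 in auto)
      then show "continuous_on {x..t} F"
        unfolding F_def using pos by (intro continuous_intros) auto
    qed (use 3 in auto)
    then have "(surv_at t has_integral (F t - F x) + (T - t)) {x..T}"
      by (rule has_integral_combine[rotated 2]) (use 3 one[of t] in auto)
    \<comment> \<open>Since \<open>F t = - (T - t)\<close>, the contribution of
      \<open>{t..T}\<close> cancels and \<open>- F x\<close> remains.\<close>
    moreover have "(F t - F x) + (T - t) = (T - x) * surv_after t x"
      using 3 pos by (simp add: F_def surv_after_def)
    ultimately show ?thesis by simp
  qed
qed

lemma uniform_nn_integral_surv_at:
  assumes "x < T" "t \<le> T"
  shows "(\<integral>\<^sup>+y. surv_at t y \<partial>uniform_measure lborel {x<..<T}) = surv_after t x"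
proof -
  have AE: "AE y in lborel. y \<noteq> x \<and> y \<noteq> T"
    using AE_lborel_singleton[of x] AE_lborel_singleton[of T] by auto
  have "(\<integral>\<^sup>+y. surv_at t y \<partial>uniform_measure lborel {x<..<T})
      = (\<integral>\<^sup>+y. ennreal (surv_at t y) * indicator {x<..<T} y \<partial>lborel) / emeasure lborel {x<..<T}"
    by (rule nn_integral_uniform_measure) auto
  also have "(\<integral>\<^sup>+y. ennreal (surv_at t y) * indicator {x<..<T} y \<partial>lborel)
      = (\<integral>\<^sup>+y. ennreal (surv_at t y) * indicator {x..T} y \<partial>lborel)"
    by (rule nn_integral_cong_AE, rule eventually_mono[OF AE]) (auto simp: indicator_def)
  also have "\<dots> = ennreal ((T - x) * surv_after t x)"
    using assms by (intro nn_integral_has_integral_lebesgue' surv_at_has_integral surv_at_bounds) auto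
  finally show ?thesis
    using assms surv_after_bounds[of t x] by (simp add: divide_ennreal)
qed

text \<open>Approaching from the left respects both jumps: \<open>bid_prob\<close> still has the
  value \<open>\<alpha>\<^sub>2\<close> at \<open>T - d\<close>, and the indicator of
  \<open>t < x\<close> is still 0 at \<open>x = t\<close>. Continuity from the right can fail at
  these points.\<close>

lemma surv_at_tendsto_left:
  assumes "x \<le> T" "t \<le> T"
  shows "(surv_at t \<longlongrightarrow> surv_at t x) (at_left x)"
proof -
  have surv: "(surv \<longlongrightarrow> surv x) (at_left x)"
  proof -
    have "(surv \<longlongrightarrow> surv x) (at x within {..T})"
      using continuous_on_surv assms by (auto simp: continuous_on_def)
    then show ?thesis by (rule tendsto_within_subset) (use assms in auto)
  qed
  have less: "\<forall>\<^sub>F y in at_left x. y < x" by (simp add: eventually_at_filter)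
  have greater: "\<forall>\<^sub>F y in at_left x. c < y" if "c < x" for c
    using that by (auto simp: eventually_at_left_field)
  have bid: "\<forall>\<^sub>F y in at_left x. bid_prob y = bid_prob x"
  proof (cases "x \<le> T - d")
    case True
    show ?thesis by (rule eventually_mono[OF less]) (use True in \<open>simp add: bid_prob_def\<close>)
  next
    case False
    then have "\<forall>\<^sub>F y in at_left x. T - d < y" by (intro greater) simp
    then show ?thesis by (rule eventually_mono) (use False in \<open>simp add: bid_prob_def\<close>)
  qed
  show ?thesis
  proof (cases "t < x")
    case True
    then have "\<forall>\<^sub>F y in at_left x. surv_at t y = surv_at t x"
      using greater[of t] by (auto elim!: eventually_mono simp: surv_at_beyond)
    then show ?thesis by (rule tendsto_eventually)
  next
    case x_le: False
    have eq: "\<forall>\<^sub>F y in at_left x. surv_at t y = (1 - bid_prob x) * (surv t / surv y)"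
      using less bid by eventually_elim (use x_le in \<open>auto simp: surv_at_def surv_after_def\<close>)
    have "((\<lambda>y. (1 - bid_prob x) * (surv t / surv y)) \<longlongrightarrow> (1 - bid_prob x) * (surv t / surv x)) (at_left x)"
    proof (cases "x = T")
      \<comment> \<open>Here \<open>surv y\<close> tends to 0, but \<open>t = T\<close> as well, so
        the numerator \<open>surv t\<close> is 0 throughout.\<close>
      case True
      then have "t = T" using x_le assms by simp
      then show ?thesis by simp
    next
      case False
      then show ?thesis using surv_pos[of x] assms by (intro tendsto_intros surv) auto
    qed
    then have "(surv_at t \<longlongrightarrow> (1 - bid_prob x) * (surv t / surv x)) (at_left x)"
      using tendsto_cong[OF eq] by simp
    then show ?thesis using x_le by (simp add: surv_at_def surv_after_def)
  qed
qed

text \<open>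
  The probability of placing a bid by time \<open>t\<close>, given the arrival time \<open>x\<close> and for a uniform
  arrival time: a bid after \<open>T - d\<close> is placed only by a bidder who does not depart.
\<close>

definition placed_at :: "real \<Rightarrow> real \<Rightarrow> real" where
  "placed_at t x = 1 - surv_at (min t (T - d)) x
     + (\<alpha>\<^sub>2 / \<alpha>\<^sub>3) * (surv_at (min t (T - d)) x - surv_at t x)"

definition placed :: "real \<Rightarrow> real" where
  "placed t = 1 - surv (min t (T - d)) + (\<alpha>\<^sub>2 / \<alpha>\<^sub>3) * (surv (min t (T - d)) - surv t)"

lemma placed_at_measurable [measurable]: "placed_at t \<in> borel_measurable borel"
  unfolding placed_at_def[abs_def] by measurable

text \<open>Arriving uniformly on \<open>[0, T]\<close> is like choosing the next potential bid time
  after 0: the integral is the case \<open>x = 0\<close> of \<open>surv_at_has_integral\<close>,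
  where \<open>surv 0 = 1\<close>.\<close>

lemma placed_at_has_integral:
  assumes "0 \<le> t" "t \<le> T"
  shows "(placed_at t has_integral T * placed t) {0..T}"
proof -
  have *: "(surv_at s has_integral T * surv s) {0..T}" if "0 \<le> s" "s \<le> T" for s
    using surv_at_has_integral[of 0 s] that T_pos by (simp add: surv_after_def)
  have "((\<lambda>_. 1) has_integral T) {0..T}"
    using has_integral_const_real[of "1::real" 0 T] T_pos by simp
  then have "(placed_at t has_integral T - T * surv (min t (T - d))
     + (\<alpha>\<^sub>2 / \<alpha>\<^sub>3) * (T * surv (min t (T - d)) - T * surv t)) {0..T}"
    unfolding placed_at_def[abs_def] using assms d_pos d_less
    by (intro has_integral_add has_integral_diff has_integral_mult_right *) auto
  then show ?thesis by (simp add: placed_def algebra_simps)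
qed

lemma placed_at_tendsto_left:
  assumes "x \<le> T" "t \<le> T"
  shows "(placed_at t \<longlongrightarrow> placed_at t x) (at_left x)"
  unfolding placed_at_def[abs_def] using assms d_pos
  by (intro tendsto_intros surv_at_tendsto_left) auto

lemma ratio_bounds: "0 \<le> \<alpha>\<^sub>2 / \<alpha>\<^sub>3" "\<alpha>\<^sub>2 / \<alpha>\<^sub>3 \<le> 1"
  using \<alpha>\<^sub>2_pos \<alpha>\<^sub>2_le by auto

section \<open>The intensity of the bids and its primitive\<close>

definition intensity :: "real \<Rightarrow> real \<Rightarrow> real" where
  "intensity c t = (if t < T - d then c * (1 - t / T) powr (\<alpha>\<^sub>2 - 1)
     else c * (d / T) powr (\<alpha>\<^sub>2 - \<alpha>\<^sub>3) * (1 - t / T) powr (\<alpha>\<^sub>3 - 1))"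

lemma intensity_nonneg: "0 \<le> c \<Longrightarrow> 0 \<le> intensity c t"
  by (simp add: intensity_def)

lemma intensity_measurable [measurable]: "intensity c \<in> borel_measurable borel"
  unfolding intensity_def[abs_def] by measurable

lemma continuous_on_placed: "continuous_on {0..T} placed"
proof -
  have surv: "continuous_on {0..T} surv"
    by (rule continuous_on_subset[OF continuous_on_surv]) auto
  have "continuous_on {0..T} (\<lambda>t. surv (min t (T - d)))"
    by (rule continuous_on_compose2[OF continuous_on_surv]) (use d_pos in \<open>auto intro!: continuous_intros\<close>)
  with surv show ?thesis unfolding placed_def[abs_def] by (intro continuous_intros)
qed

text \<open>The derivative is the hazard times \<open>surv t\<close>. After \<open>T - d\<close> the
  hazard factor \<open>\<alpha>\<^sub>3\<close> is multiplied by the share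
  \<open>\<alpha>\<^sub>2 / \<alpha>\<^sub>3\<close> of bidders who do not depart, which leaves the
  same \<open>\<alpha>\<^sub>2\<close> as before \<open>T - d\<close>.\<close>

lemma placed_derivative:
  assumes "0 < t" "t < T" "t \<noteq> T - d"
  shows "((\<lambda>t. r * T * placed t) has_real_derivative intensity (r * \<alpha>\<^sub>2) t) (at t)"
proof (cases "t < T - d")
  case True
  have "((\<lambda>t. r * T * (1 - surv t)) has_real_derivative - (r * T * (- (bid_prob t / (T - t)) * surv t))) (at t)"
    by (rule derivative_eq_intros surv_derivative assms refl)+ simp
  also have "- (r * T * (- (bid_prob t / (T - t)) * surv t)) = intensity (r * \<alpha>\<^sub>2) t"
  proof -
    have "1 - t / T = (T - t) / T" using T_pos by (simp add: field_simps)
    then show ?thesis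
      using True assms T_pos by (simp add: bid_prob_def surv_def intensity_def powr_diff)
  qed
  finally show ?thesis
    by (rule DERIV_cong_ev[OF refl _ refl, THEN iffD1, rotated])
      (use True in \<open>auto simp: placed_def eventually_nhds intro!: exI[of _ "{..<T - d}"]\<close>)
next
  case False
  \<comment> \<open>From \<open>T - d\<close> on, \<open>min t (T - d)\<close> is frozen;
    \<open>k\<close> collects the constant part of \<open>placed t\<close>.\<close>
  define k where "k = 1 - surv (T - d) + (\<alpha>\<^sub>2 / \<alpha>\<^sub>3) * surv (T - d)"
  have "((\<lambda>t. r * T * (k - (\<alpha>\<^sub>2 / \<alpha>\<^sub>3) * surv t)) has_real_derivative
      - (r * T * ((\<alpha>\<^sub>2 / \<alpha>\<^sub>3) * (- (bid_prob t / (T - t)) * surv t)))) (at t)"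
    by (rule derivative_eq_intros surv_derivative assms refl)+ (simp add: mult_ac)
  also have "- (r * T * ((\<alpha>\<^sub>2 / \<alpha>\<^sub>3) * (- (bid_prob t / (T - t)) * surv t))) = intensity (r * \<alpha>\<^sub>2) t"
  proof -
    have "1 - t / T = (T - t) / T" using T_pos by (simp add: field_simps)
    then show ?thesis
      using False assms T_pos d_pos \<alpha>\<^sub>2_pos \<alpha>\<^sub>2_le
      by (simp add: bid_prob_def surv_def intensity_def powr_diff powr_divide field_simps)
  qed
  finally show ?thesis
    by (rule DERIV_cong_ev[OF refl _ refl, THEN iffD1, rotated])
      (use False assms in \<open>auto simp: placed_def k_def eventually_nhds algebra_simps intro!: exI[of _ "{T - d<..}"]\<close>)
qed

text \<open>For \<open>\<alpha>\<^sub>3 < 1\<close> the intensity is unbounded near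
  \<open>T\<close>. It is nonnegative, however, and its primitive \<open>r * T * placed\<close> is
  continuous up to \<open>T\<close>, so the fundamental theorem yields integrability together with
  the value.\<close>

lemma intensity_integral:
  assumes "0 \<le> r"
  shows "set_integrable lborel {0..T} (intensity (r * \<alpha>\<^sub>2))"
    and "0 \<le> u \<Longrightarrow> u \<le> v \<Longrightarrow> v \<le> T \<Longrightarrow>
      (LINT s:{u<..v}|lborel. intensity (r * \<alpha>\<^sub>2) s) = r * T * (placed v - placed u)"
proof -
  have FTC: "(intensity (r * \<alpha>\<^sub>2) has_integral r * T * placed v - r * T * placed u) {u..v}"
    if "0 \<le> u" "u \<le> v" "v \<le> T" for u v
  proof (rule fundamental_theorem_of_calculus_interior_strong[of "{T - d}"])
    have "continuous_on {u..v} placed"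
      by (rule continuous_on_subset[OF continuous_on_placed]) (use that in auto)
    then show "continuous_on {u..v} (\<lambda>t. r * T * placed t)" by (intro continuous_intros)
    show "((\<lambda>t. r * T * placed t) has_vector_derivative intensity (r * \<alpha>\<^sub>2) t) (at t)"
      if "t \<in> {u<..<v} - {T - d}" for t
      using placed_derivative[of t r] that \<open>0 \<le> u\<close> \<open>v \<le> T\<close>
      by (auto simp: has_real_derivative_iff_has_vector_derivative)
  qed (use that in auto)
  have nonneg: "0 \<le> intensity (r * \<alpha>\<^sub>2) x" for x
    using assms \<alpha>\<^sub>2_pos by (simp add: intensity_nonneg)
  show int: "set_integrable lborel {0..T} (intensity (r * \<alpha>\<^sub>2))"
    unfolding set_integrable_def
  proof (rule integrableI_bounded)
    have "(\<integral>\<^sup>+x. norm (indicator {0..T} x *\<^sub>R intensity (r * \<alpha>\<^sub>2) x) \<partial>lborel)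
       = (\<integral>\<^sup>+x. ennreal (intensity (r * \<alpha>\<^sub>2) x) * indicator {0..T} x \<partial>lborel)"
      by (rule nn_integral_cong) (auto simp: indicator_def nonneg)
    also have "\<dots> = ennreal (r * T * placed T - r * T * placed 0)"
      using T_pos nonneg FTC[of 0 T] by (intro nn_integral_has_integral_lebesgue') auto
    finally show "(\<integral>\<^sup>+x. norm (indicator {0..T} x *\<^sub>R intensity (r * \<alpha>\<^sub>2) x) \<partial>lborel) < \<infinity>" by simp
  qed simp
  show "(LINT s:{u<..v}|lborel. intensity (r * \<alpha>\<^sub>2) s) = r * T * (placed v - placed u)"
    if uv: "0 \<le> u" "u \<le> v" "v \<le> T"
  proof -
    have "set_integrable lborel {u<..v} (intensity (r * \<alpha>\<^sub>2))"
      by (rule set_integrable_subset[OF int]) (use uv in auto)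
    then have "(LINT s:{u<..v}|lborel. intensity (r * \<alpha>\<^sub>2) s) = integral {u<..v} (intensity (r * \<alpha>\<^sub>2))"
      by (rule set_borel_integral_eq_integral)
    also have "\<dots> = integral {u..v} (intensity (r * \<alpha>\<^sub>2))"
      by (rule integral_spike_set; rule negligible_subset[of "{u}"]) auto
    also have "\<dots> = r * T * (placed v - placed u)"
      using FTC[OF uv] by (simp add: integral_unique right_diff_distrib)
    finally show ?thesis .
  qed
qed

end

subsection \<open>Conditioning on the decisions of one bidder\<close>

lemma space_generated_by [simp]: "space (generated_by M \<X> \<E>) = space M"
  by (simp add: generated_by_def space_measure_of_conv)

lemma sets_generated_by:
  assumes "\<E> \<subseteq> Pow (space M)"
  shows "sets (generated_by M \<X> \<E>) =
    sigma_sets (space M) ({X -` C \<inter> space M | X C. X \<in> \<X> \<and> C \<in> sets borel} \<union> \<E>)"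
  unfolding generated_by_def using assms by (intro sets_measure_of) auto

lemma generated_by_sets:
  assumes "\<E> \<subseteq> Pow (space M)" "A \<in> \<E>"
  shows "A \<in> sets (generated_by M \<X> \<E>)"
  using assms by (auto simp: sets_generated_by)

lemma generated_by_measurable:
  assumes "\<E> \<subseteq> Pow (space M)" "X \<in> \<X>"
  shows "X \<in> borel_measurable (generated_by M \<X> \<E>)"
  using assms by (intro measurableI) (auto simp: sets_generated_by intro!: sigma_sets.Basic)

lemma generated_by_subset:
  assumes "space N = space M" "\<X> \<subseteq> borel_measurable N" "\<E> \<subseteq> sets N"
  shows "sets (generated_by M \<X> \<E>) \<subseteq> sets N"
proof -
  have "\<E> \<subseteq> Pow (space M)" using assms(3) sets.space_closed[of N] unfolding assms(1) by (rule subset_trans)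
  moreover have "{X -` C \<inter> space M | X C. X \<in> \<X> \<and> C \<in> sets borel} \<union> \<E> \<subseteq> sets N"
  proof -
    have "X -` C \<inter> space M \<in> sets N" if "X \<in> \<X>" "C \<in> sets borel" for X C
      using measurable_sets[of X N borel C] assms(1,2) that by auto
    then show ?thesis using assms(3) by blast
  qed
  ultimately show ?thesis
    using sets.sigma_sets_subset[of _ N] assms(1) by (simp add: sets_generated_by)
qed

lemma measurable_from_larger:
  assumes "f \<in> measurable F N" "space F = space G" "sets F \<subseteq> sets G"
  shows "f \<in> measurable G N"
  using assms by (auto simp: measurable_def)

lemma generated_by_mono:
  assumes "\<X> \<subseteq> \<X>'" "\<E> \<subseteq> \<E>'" "\<E>' \<subseteq> Pow (space M)"
  shows "sets (generated_by M \<X> \<E>) \<subseteq> sets (generated_by M \<X>' \<E>')"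
  using assms generated_by_sets[of \<E>' M _ \<X>'] generated_by_measurable[of \<E>' M _ \<X>']
  by (intro generated_by_subset) auto

text \<open>The conditional probability has to be known only where \<open>Z\<close> does not vanish.
  The bid rule prescribes it on just such an event, and a factor \<open>Z\<close> supported there
  turns the rule into an identity of expectations.\<close>

lemma (in prob_space) expectation_times_indicator_if_cond_exp:
  assumes sub: "subalgebra M F" and Z: "Z \<in> borel_measurable F"
    and bound: "\<And>\<omega>. \<omega> \<in> space M \<Longrightarrow> \<bar>Z \<omega>\<bar> \<le> C"
    and A [measurable]: "A \<in> sets M" and h [measurable]: "h \<in> borel_measurable M"
    and cond: "AE \<omega> in M. Z \<omega> \<noteq> 0 \<longrightarrow> real_cond_exp M F (indicator A) \<omega> = h \<omega>"
  shows "expectation (\<lambda>\<omega>. Z \<omega> * indicator A \<omega>) = expectation (\<lambda>\<omega>. Z \<omega> * h \<omega>)"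
proof -
  interpret sigma_finite_subalgebra M F
    using sub by (intro finite_measure_subalgebra_is_sigma_finite finite_measure_subalgebra.intro
        finite_measure_axioms finite_measure_subalgebra_axioms.intro)
  have Z' [measurable]: "Z \<in> borel_measurable M"
    using measurable_from_subalg[OF sub Z] .
  have int: "integrable M (\<lambda>\<omega>. Z \<omega> * indicator A \<omega>)"
  proof (rule integrable_const_bound[of _ C])
    have "norm (Z \<omega> * indicator A \<omega>) \<le> C" if "\<omega> \<in> space M" for \<omega>
      using bound[OF that] by (auto simp: indicator_def)
    then show "AE \<omega> in M. norm (Z \<omega> * indicator A \<omega>) \<le> C" by (rule AE_I2)
  qed measurable
  have "expectation (\<lambda>\<omega>. Z \<omega> * indicator A \<omega>) = expectation (\<lambda>\<omega>. Z \<omega> * real_cond_exp M F (indicator A) \<omega>)"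
    by (rule real_cond_exp_intg(2)[symmetric, OF int Z]) measurable
  also have "\<dots> = expectation (\<lambda>\<omega>. Z \<omega> * h \<omega>)"
    using cond by (intro integral_cong_AE) (auto elim!: eventually_mono)
  finally show ?thesis .
qed

context bidding
begin

abbreviation next_law :: "real \<Rightarrow> real measure" where
  "next_law x \<equiv> uniform_measure lborel {x<..<T}"

lemma prob_space_next_law: "x < T \<Longrightarrow> prob_space (next_law x)"
  by (rule prob_space_uniform_measure) auto

text \<open>The interval of integration moves with \<open>x\<close>. Over the fixed measure
  \<open>lborel\<close> its indicator becomes a jointly measurable factor;
  \<open>max 0 (T - x)\<close> covers the empty interval.\<close>

lemma nn_integral_next_law_measurable [measurable]:
  assumes [measurable]: "u \<in> borel_measurable borel"
  shows "(\<lambda>x. \<integral>\<^sup>+y. u y \<partial>next_law x) \<in> borel_measurable borel"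
proof -
  have "(\<integral>\<^sup>+y. u y \<partial>next_law x) = (\<integral>\<^sup>+y. u y * (if x < y \<and> y < T then 1 else 0) \<partial>lborel) / ennreal (max 0 (T - x))" for x
  proof -
    have "emeasure lborel {x<..<T} = ennreal (max 0 (T - x))"
      by (cases "x \<le> T") (auto simp: max_def)
    moreover have "(\<integral>\<^sup>+y. u y * indicator {x<..<T} y \<partial>lborel) = (\<integral>\<^sup>+y. u y * (if x < y \<and> y < T then 1 else 0) \<partial>lborel)"
      by (intro nn_integral_cong) (auto simp: indicator_def)
    ultimately show ?thesis by (simp add: nn_integral_uniform_measure)
  qed
  then show ?thesis by simp
qed

lemma measure_next_law_measurable [measurable]:
  assumes [measurable]: "A \<in> sets borel"
  shows "(\<lambda>x. measure (next_law x) A) \<in> borel_measurable borel"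
proof -
  have "(\<lambda>x. measure (next_law x) A) = (\<lambda>x. enn2real (\<integral>\<^sup>+y. indicator A y \<partial>next_law x))"
    by (simp add: measure_def fun_eq_iff)
  also have "\<dots> \<in> borel_measurable borel" by measurable
  finally show ?thesis .
qed

end

text \<open>\<open>G\<close>, \<open>\<X>\<close> and \<open>\<E>\<close> stay abstract so that one
  analysis serves both models: a random bidder has \<open>G = space M\<close> and no outside
  information, while for a bidder of the auction all arrivals, the number \<open>K\<close> and the
  other bidders are outside.\<close>

locale bidder = bidding + prob_space M
  for M :: "'a measure" +
  fixes G :: "'a set" and \<X> :: "('a \<Rightarrow> real) set" and \<E> :: "'a set set"
    and S :: "nat \<Rightarrow> 'a \<Rightarrow> real" and B :: "nat \<Rightarrow> 'a set" and D :: "'a set"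
  assumes outside: "\<X> \<subseteq> borel_measurable M" "\<E> \<subseteq> sets M"
    and exists: "G \<in> sets (generated_by M \<X> \<E>)"
    and rule: "follows_bid_rule T d \<alpha>\<^sub>2 \<alpha>\<^sub>3 M G \<X> \<E> S B D"
begin

text \<open>
  The information on which the departure, the decision to bid at \<open>S k\<close> and the choice of
  \<open>S (Suc k)\<close>, respectively, are conditioned.
\<close>

definition "FD = generated_by M (\<X> \<union> {S 0}) \<E>"
definition "FB k = generated_by M (\<X> \<union> S ` {..k}) (\<E> \<union> {D} \<union> B ` {..<k})"
definition "FS k = generated_by M (\<X> \<union> S ` {..k}) (\<E> \<union> {D} \<union> B ` {..k})"

lemma S_measurable [measurable]: "S k \<in> borel_measurable M"
  and B_sets [measurable]: "B k \<in> sets M"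
  and D_sets [measurable]: "D \<in> sets M"
  using rule by (auto simp: follows_bid_rule_def)

lemma events: "\<E> \<union> {D} \<union> B ` I \<subseteq> sets M"
  using outside by auto

lemma events_Pow: "\<E> \<union> {D} \<union> B ` I \<subseteq> Pow (space M)" "\<E> \<subseteq> Pow (space M)"
  using events sets.sets_into_space outside by blast+

lemma subalgebras: "subalgebra M FD" "subalgebra M (FB k)" "subalgebra M (FS k)"
proof -
  have S: "\<X> \<union> S ` I \<subseteq> borel_measurable M" for I
    using outside(1) by auto
  show "subalgebra M FD"
    using generated_by_subset[OF refl S[of "{0}"] outside(2)] unfolding FD_def subalgebra_def by simp
  show "subalgebra M (FB k)" "subalgebra M (FS k)"
    using generated_by_subset[OF refl S events] unfolding FB_def FS_def subalgebra_def by simp_all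
qed

lemma space_F [simp]: "space FD = space M" "space (FB k) = space M" "space (FS k) = space M"
  by (simp_all add: FD_def FB_def FS_def)

lemma FD_subset_FB: "sets FD \<subseteq> sets (FB 0)"
  unfolding FD_def FB_def by (rule generated_by_mono[OF _ _ events_Pow(1)]) auto

lemma FB_subset_FS: "sets (FB k) \<subseteq> sets (FS k)"
  unfolding FB_def FS_def by (rule generated_by_mono[OF _ _ events_Pow(1)]) auto

lemma FB_mono: "j \<le> k \<Longrightarrow> sets (FB j) \<subseteq> sets (FB k)"
  unfolding FB_def by (rule generated_by_mono[OF _ _ events_Pow(1)]) auto

lemma S_FB: "S k \<in> borel_measurable (FB k)"
  unfolding FB_def by (rule generated_by_measurable[OF events_Pow(1)]) auto

lemma B_FB: "j < k \<Longrightarrow> B j \<in> sets (FB k)"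
  unfolding FB_def by (rule generated_by_sets[OF events_Pow(1)]) auto

lemma B_FS: "B k \<in> sets (FS k)"
  unfolding FS_def by (rule generated_by_sets[OF events_Pow(1)]) auto

lemma D_FB: "D \<in> sets (FB 0)"
  unfolding FB_def by (rule generated_by_sets[OF events_Pow(1)]) auto

lemma G_FB: "G \<in> sets (FB 0)"
proof -
  have "sets (generated_by M \<X> \<E>) \<subseteq> sets (FB 0)"
    unfolding FB_def by (rule generated_by_mono[OF _ _ events_Pow(1)]) auto
  then show ?thesis using exists by auto
qed

lemma expectation_depart:
  assumes "Z \<in> borel_measurable FD" "\<And>\<omega>. \<omega> \<in> space M \<Longrightarrow> \<bar>Z \<omega>\<bar> \<le> C"
    and "\<And>\<omega>. \<omega> \<in> space M \<Longrightarrow> \<omega> \<notin> G \<Longrightarrow> Z \<omega> = 0"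
  shows "expectation (\<lambda>\<omega>. Z \<omega> * indicator D \<omega>) = expectation (\<lambda>\<omega>. Z \<omega> * (1 - \<alpha>\<^sub>2 / \<alpha>\<^sub>3))"
proof (rule expectation_times_indicator_if_cond_exp[OF subalgebras(1) assms(1,2)])
  have "AE \<omega> in M. \<omega> \<in> G \<longrightarrow> real_cond_exp M FD (indicator D) \<omega> = 1 - \<alpha>\<^sub>2 / \<alpha>\<^sub>3"
    using rule unfolding follows_bid_rule_def FD_def by blast
  then show "AE \<omega> in M. Z \<omega> \<noteq> 0 \<longrightarrow> real_cond_exp M FD (indicator D) \<omega> = 1 - \<alpha>\<^sub>2 / \<alpha>\<^sub>3"
    using AE_space by eventually_elim (use assms(3) in blast)
qed auto

text \<open>The support condition on \<open>Z\<close> matches the event on which the decision at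
  \<open>S k\<close> has a prescribed law: the bidder exists and no earlier decision was to
  bid.\<close>

lemma expectation_bid:
  assumes "Z \<in> borel_measurable (FB k)" "\<And>\<omega>. \<omega> \<in> space M \<Longrightarrow> \<bar>Z \<omega>\<bar> \<le> C"
    and "\<And>\<omega>. \<omega> \<in> space M \<Longrightarrow> \<omega> \<notin> G - (\<Union>j<k. B j) \<Longrightarrow> Z \<omega> = 0"
  shows "expectation (\<lambda>\<omega>. Z \<omega> * indicator (B k) \<omega>) = expectation (\<lambda>\<omega>. Z \<omega> * bid_prob (S k \<omega>))"
proof (rule expectation_times_indicator_if_cond_exp[OF subalgebras(2) assms(1,2)])
  have "AE \<omega> in M. \<omega> \<in> G - (\<Union>j<k. B j) \<longrightarrow> real_cond_exp M (FB k) (indicator (B k)) \<omega> = bid_prob (S k \<omega>)"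
    using rule unfolding follows_bid_rule_def FB_def bid_prob_def by blast
  then show "AE \<omega> in M. Z \<omega> \<noteq> 0 \<longrightarrow> real_cond_exp M (FB k) (indicator (B k)) \<omega> = bid_prob (S k \<omega>)"
    using AE_space by eventually_elim (use assms(3) in blast)
qed auto

lemma next_rule:
  assumes "C \<in> sets borel"
  shows "AE \<omega> in M. \<omega> \<in> G - (\<Union>j\<le>k. B j) \<longrightarrow>
    real_cond_exp M (FS k) (indicator (S (Suc k) -` C \<inter> space M)) \<omega> = measure (next_law (S k \<omega>)) C"
  using rule assms unfolding follows_bid_rule_def FS_def by blast

text \<open>
  The conditional law of the next potential bid time has mass 1, so that it exists only after a
  potential bid time before \<open>T\<close>.
\<close>

lemma AE_less_T: "AE \<omega> in M. \<omega> \<in> G - (\<Union>j\<le>k. B j) \<longrightarrow> S k \<omega> < T"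
proof -
  interpret F: sigma_finite_subalgebra M "FS k"
    using subalgebras(3) by (intro finite_measure_subalgebra_is_sigma_finite finite_measure_subalgebra.intro
        finite_measure_axioms finite_measure_subalgebra_axioms.intro)
  have "space M \<in> sets (FS k)" using sets.top[of "FS k"] by simp
  then have "indicator (space M) \<in> borel_measurable (FS k)" by measurable
  then have "AE \<omega> in M. real_cond_exp M (FS k) (indicator (space M)) \<omega> = indicator (space M) \<omega>"
    by (intro F.real_cond_exp_F_meas) (auto simp: emeasure_space_1)
  with next_rule[OF sets.top[of borel, unfolded space_borel], of k] AE_space show ?thesis
  proof eventually_elim
    case (elim \<omega>)
    show ?case
    proof (rule ccontr)
      assume neg: "\<not> (\<omega> \<in> G - (\<Union>j\<le>k. B j) \<longrightarrow> S k \<omega> < T)"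
      \<comment> \<open>For \<open>T \<le> S k \<omega>\<close> the interval is empty, and the
        formal uniform measure has mass 0 instead of 1.\<close>
      then have "next_law (S k \<omega>) = uniform_measure lborel {}" by simp
      then show False using elim neg by (simp add: measure_def)
    qed
  qed
qed

text \<open>The exceptional null set in \<open>next_rule\<close> depends on the Borel set
  \<open>C\<close>, so the rule is not directly a statement about a kernel. Once it is integrated
  against \<open>Z\<close>, it extends from indicators to nonnegative \<open>u\<close> by linearity
  and monotone convergence.\<close>

lemma nn_integral_next:
  assumes Z: "Z \<in> borel_measurable (FS k)" and bound: "\<And>\<omega>. \<omega> \<in> space M \<Longrightarrow> 0 \<le> Z \<omega> \<and> Z \<omega> \<le> C"
    and zero: "\<And>\<omega>. \<omega> \<in> space M \<Longrightarrow> \<omega> \<notin> G - (\<Union>j\<le>k. B j) \<Longrightarrow> Z \<omega> = 0"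
    and "u \<in> borel_measurable borel"
  shows "(\<integral>\<^sup>+\<omega>. ennreal (Z \<omega>) * u (S (Suc k) \<omega>) \<partial>M)
    = (\<integral>\<^sup>+\<omega>. ennreal (Z \<omega>) * (\<integral>\<^sup>+y. u y \<partial>next_law (S k \<omega>)) \<partial>M)"
proof -
  have [measurable]: "Z \<in> borel_measurable M"
    using measurable_from_subalg[OF subalgebras(3) Z] .
  have AE: "AE \<omega> in M. 0 \<le> Z \<omega> \<and> Z \<omega> \<le> C \<and> (Z \<omega> \<noteq> 0 \<longrightarrow> S k \<omega> < T)"
    using AE_less_T[of k] AE_space by eventually_elim (use zero bound in blast)
  from \<open>u \<in> borel_measurable borel\<close> show ?thesis
  proof (induction u rule: borel_measurable_induct)
    case (cong f g)
    then have "f = g" by auto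
    then show ?case using cong by simp
  next
    case (set A)
    then have [measurable]: "A \<in> sets borel" by simp
    have "expectation (\<lambda>\<omega>. Z \<omega> * indicator (S (Suc k) -` A \<inter> space M) \<omega>)
        = expectation (\<lambda>\<omega>. Z \<omega> * measure (next_law (S k \<omega>)) A)"
    proof (rule expectation_times_indicator_if_cond_exp[OF subalgebras(3) Z, where C = C])
      show "AE \<omega> in M. Z \<omega> \<noteq> 0 \<longrightarrow> real_cond_exp M (FS k) (indicator (S (Suc k) -` A \<inter> space M)) \<omega>
          = measure (next_law (S k \<omega>)) A"
        using next_rule[OF set(1), of k] AE_space by eventually_elim (use zero in blast)
    qed (use bound in auto)
    moreover have "(\<integral>\<^sup>+\<omega>. ennreal (Z \<omega>) * indicator A (S (Suc k) \<omega>) \<partial>M)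
        = ennreal (expectation (\<lambda>\<omega>. Z \<omega> * indicator (S (Suc k) -` A \<inter> space M) \<omega>))"
    proof (subst nn_integral_eq_integral[symmetric])
      show "integrable M (\<lambda>\<omega>. Z \<omega> * indicator (S (Suc k) -` A \<inter> space M) \<omega>)"
      proof (rule integrable_const_bound[of _ C])
        show "AE \<omega> in M. norm (Z \<omega> * indicator (S (Suc k) -` A \<inter> space M) \<omega>) \<le> C"
          using AE by eventually_elim (simp add: indicator_def)
      qed measurable
      show "AE \<omega> in M. 0 \<le> Z \<omega> * indicator (S (Suc k) -` A \<inter> space M) \<omega>"
        using bound by (intro AE_I2) auto
    qed (auto intro!: nn_integral_cong simp: indicator_def)
    moreover have "(\<integral>\<^sup>+\<omega>. ennreal (Z \<omega>) * (\<integral>\<^sup>+y. indicator A y \<partial>next_law (S k \<omega>)) \<partial>M)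
        = ennreal (expectation (\<lambda>\<omega>. Z \<omega> * measure (next_law (S k \<omega>)) A))"
    proof (subst nn_integral_eq_integral[symmetric])
      \<comment> \<open>Where \<open>Z\<close> is not 0, the law of the next potential bid time is a
        probability measure, which gives the bound \<open>C\<close>; elsewhere everything
        vanishes.\<close>
      have AE': "AE \<omega> in M. 0 \<le> Z \<omega> \<and> Z \<omega> \<le> C \<and> Z \<omega> * measure (next_law (S k \<omega>)) A \<le> C \<and>
          ennreal (Z \<omega>) * emeasure (next_law (S k \<omega>)) A = ennreal (Z \<omega> * measure (next_law (S k \<omega>)) A)"
        using AE
      proof eventually_elim
        case (elim \<omega>)
        show ?case
        proof (cases "Z \<omega> = 0")
          case False
          then interpret N: prob_space "next_law (S k \<omega>)"
            using elim by (intro prob_space_next_law) auto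
          have "Z \<omega> * measure (next_law (S k \<omega>)) A \<le> Z \<omega> * 1"
            using elim by (intro mult_left_mono N.prob_le_1) auto
          then show ?thesis
            using elim by (simp add: N.emeasure_eq_measure ennreal_mult del: emeasure_uniform_measure measure_uniform_measure)
        qed (use elim in auto)
      qed
      show "integrable M (\<lambda>\<omega>. Z \<omega> * measure (next_law (S k \<omega>)) A)"
      proof (rule integrable_const_bound[of _ C])
        show "AE \<omega> in M. norm (Z \<omega> * measure (next_law (S k \<omega>)) A) \<le> C"
          using AE' by eventually_elim (simp add: abs_mult del: emeasure_uniform_measure measure_uniform_measure)
      qed measurable
      show "AE \<omega> in M. 0 \<le> Z \<omega> * measure (next_law (S k \<omega>)) A"
        using bound by (intro AE_I2) (auto simp del: measure_uniform_measure)
      show "(\<integral>\<^sup>+\<omega>. ennreal (Z \<omega>) * (\<integral>\<^sup>+y. indicator A y \<partial>next_law (S k \<omega>)) \<partial>M)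
          = (\<integral>\<^sup>+\<omega>. ennreal (Z \<omega> * measure (next_law (S k \<omega>)) A) \<partial>M)"
        by (rule nn_integral_cong_AE, rule eventually_mono[OF AE'])
          (simp del: emeasure_uniform_measure measure_uniform_measure)
    qed
    ultimately show ?case by simp
  next
    case (mult u c)
    have [measurable]: "u \<in> borel_measurable borel" by fact
    have "(\<integral>\<^sup>+\<omega>. ennreal (Z \<omega>) * (c * u (S (Suc k) \<omega>)) \<partial>M) = c * (\<integral>\<^sup>+\<omega>. ennreal (Z \<omega>) * u (S (Suc k) \<omega>) \<partial>M)"
      by (subst nn_integral_cmult[symmetric]) (auto simp: mult_ac)
    also have "\<dots> = c * (\<integral>\<^sup>+\<omega>. ennreal (Z \<omega>) * (\<integral>\<^sup>+y. u y \<partial>next_law (S k \<omega>)) \<partial>M)"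
      by (simp only: mult.IH)
    also have "\<dots> = (\<integral>\<^sup>+\<omega>. ennreal (Z \<omega>) * (\<integral>\<^sup>+y. c * u y \<partial>next_law (S k \<omega>)) \<partial>M)"
      by (subst nn_integral_cmult[symmetric]) (auto simp: nn_integral_cmult mult_ac)
    finally show ?case .
  next
    case (add u v)
    have [measurable]: "u \<in> borel_measurable borel" "v \<in> borel_measurable borel" by fact+
    show ?case
      using add.IH by (simp add: nn_integral_add distrib_left)
  next
    case (seq U)
    have [measurable]: "U i \<in> borel_measurable borel" for i by fact
    have inc: "incseq (\<lambda>i. U i y)" for y using \<open>incseq U\<close> by (simp add: incseq_def le_fun_def)
    have "(\<integral>\<^sup>+\<omega>. ennreal (Z \<omega>) * (SUP i. U i) (S (Suc k) \<omega>) \<partial>M)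
        = (SUP i. \<integral>\<^sup>+\<omega>. ennreal (Z \<omega>) * U i (S (Suc k) \<omega>) \<partial>M)"
      using inc unfolding SUP_apply SUP_mult_left_ennreal
      by (intro nn_integral_monotone_convergence_SUP) (auto simp: incseq_def le_fun_def intro!: mult_left_mono)
    also have "\<dots> = (SUP i. \<integral>\<^sup>+\<omega>. ennreal (Z \<omega>) * (\<integral>\<^sup>+y. U i y \<partial>next_law (S k \<omega>)) \<partial>M)"
      by (simp only: seq.IH)
    also have "\<dots> = (\<integral>\<^sup>+\<omega>. (SUP i. ennreal (Z \<omega>) * (\<integral>\<^sup>+y. U i y \<partial>next_law (S k \<omega>))) \<partial>M)"
      using inc by (intro nn_integral_monotone_convergence_SUP[symmetric])
        (auto simp: incseq_def le_fun_def intro!: mult_left_mono nn_integral_mono)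
    also have "\<dots> = (\<integral>\<^sup>+\<omega>. ennreal (Z \<omega>) * (\<integral>\<^sup>+y. (SUP i. U i) y \<partial>next_law (S k \<omega>)) \<partial>M)"
    proof -
      have "(\<integral>\<^sup>+y. (SUP i. U i) y \<partial>next_law x) = (SUP i. \<integral>\<^sup>+y. U i y \<partial>next_law x)" for x
        using \<open>incseq U\<close> unfolding SUP_apply by (intro nn_integral_monotone_convergence_SUP) auto
      then show ?thesis by (simp add: SUP_mult_left_ennreal)
    qed
    finally show ?case .
  qed
qed

text \<open>This is \<open>nn_integral_next\<close> for \<open>surv_at t\<close>, whose mean under
  \<open>next_law x\<close> is \<open>surv_after t x\<close> when \<open>x < T\<close>. The detour
  through nonnegative integrals is the reason for taking \<open>Z\<close> nonnegative.\<close>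

lemma expectation_next:
  assumes Z: "Z \<in> borel_measurable (FS k)" and bound: "\<And>\<omega>. \<omega> \<in> space M \<Longrightarrow> 0 \<le> Z \<omega> \<and> Z \<omega> \<le> C"
    and zero: "\<And>\<omega>. \<omega> \<in> space M \<Longrightarrow> \<omega> \<notin> G - (\<Union>j\<le>k. B j) \<Longrightarrow> Z \<omega> = 0"
    and t: "t \<le> T"
  shows "expectation (\<lambda>\<omega>. Z \<omega> * surv_at t (S (Suc k) \<omega>)) = expectation (\<lambda>\<omega>. Z \<omega> * surv_after t (S k \<omega>))"
proof -
  have [measurable]: "Z \<in> borel_measurable M"
    using measurable_from_subalg[OF subalgebras(3) Z] .
  have int: "integrable M (\<lambda>\<omega>. Z \<omega> * f (S j \<omega>))" "AE \<omega> in M. 0 \<le> Z \<omega> * f (S j \<omega>)"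
    if [measurable]: "f \<in> borel_measurable borel" and f: "\<And>x. 0 \<le> f x \<and> f x \<le> 1" for f :: "real \<Rightarrow> real" and j
  proof -
    have Zf: "0 \<le> Z \<omega> * f (S j \<omega>)" "Z \<omega> * f (S j \<omega>) \<le> C" if "\<omega> \<in> space M" for \<omega>
      using bound[OF that] f[of "S j \<omega>"] mult_mono[of "Z \<omega>" C "f (S j \<omega>)" 1] by auto
    show "AE \<omega> in M. 0 \<le> Z \<omega> * f (S j \<omega>)" using Zf(1) by (rule AE_I2)
    show "integrable M (\<lambda>\<omega>. Z \<omega> * f (S j \<omega>))"
      by (rule integrable_const_bound[of _ C], rule AE_I2) (use Zf in \<open>simp_all add: abs_of_nonneg\<close>)
  qed
  have int_at: "integrable M (\<lambda>\<omega>. Z \<omega> * surv_at t (S (Suc k) \<omega>))" "AE \<omega> in M. 0 \<le> Z \<omega> * surv_at t (S (Suc k) \<omega>)"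
    and int_after: "integrable M (\<lambda>\<omega>. Z \<omega> * surv_after t (S k \<omega>))" "AE \<omega> in M. 0 \<le> Z \<omega> * surv_after t (S k \<omega>)"
    using int[of "surv_at t" "Suc k"] int[of "surv_after t" k] surv_at_bounds[OF t] surv_after_bounds[OF t]
    by simp_all
  have "ennreal (expectation (\<lambda>\<omega>. Z \<omega> * surv_at t (S (Suc k) \<omega>)))
      = (\<integral>\<^sup>+\<omega>. ennreal (Z \<omega> * surv_at t (S (Suc k) \<omega>)) \<partial>M)"
    by (rule nn_integral_eq_integral[symmetric, OF int_at])
  also have "\<dots> = (\<integral>\<^sup>+\<omega>. ennreal (Z \<omega>) * ennreal (surv_at t (S (Suc k) \<omega>)) \<partial>M)"
  proof (rule nn_integral_cong)
    show "ennreal (Z \<omega> * surv_at t (S (Suc k) \<omega>)) = ennreal (Z \<omega>) * ennreal (surv_at t (S (Suc k) \<omega>))"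
      if "\<omega> \<in> space M" for \<omega>
      using bound[OF that] surv_at_bounds[OF t] by (simp add: ennreal_mult)
  qed
  also have "\<dots> = (\<integral>\<^sup>+\<omega>. ennreal (Z \<omega>) * (\<integral>\<^sup>+y. ennreal (surv_at t y) \<partial>next_law (S k \<omega>)) \<partial>M)"
    by (rule nn_integral_next[OF Z bound zero]) auto
  also have "\<dots> = (\<integral>\<^sup>+\<omega>. ennreal (Z \<omega> * surv_after t (S k \<omega>)) \<partial>M)"
  proof (rule nn_integral_cong_AE)
    show "AE \<omega> in M. ennreal (Z \<omega>) * (\<integral>\<^sup>+y. ennreal (surv_at t y) \<partial>next_law (S k \<omega>))
        = ennreal (Z \<omega> * surv_after t (S k \<omega>))"
      using AE_less_T[of k] AE_space
    proof eventually_elim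
      case (elim \<omega>)
      show ?case
      proof (cases "Z \<omega> = 0")
        case False
        then have "S k \<omega> < T" using elim zero by blast
        then show ?thesis
          using bound[OF elim(2)] surv_after_bounds[OF t] t
          by (simp add: uniform_nn_integral_surv_at ennreal_mult)
      qed simp
    qed
  qed
  also have "\<dots> = ennreal (expectation (\<lambda>\<omega>. Z \<omega> * surv_after t (S k \<omega>)))"
    by (rule nn_integral_eq_integral[OF int_after])
  finally show ?thesis
    by (subst (asm) ennreal_inj) (rule integral_nonneg_AE int_at int_after)+
qed

end

text \<open>The measure \<open>N\<close> is arbitrary because the bids of the other bidders must be
  measurable with respect to the information \<open>FD\<close> of one bidder, and not only with
  respect to \<open>M\<close>.\<close>

lemma bid_time_measurable:
  assumes [measurable]: "\<And>k. S k \<in> borel_measurable N" "\<And>k. B k \<in> sets N"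
  shows "bid_time S B \<in> borel_measurable N"
proof -
  have "(\<lambda>\<omega>. LEAST k. \<omega> \<in> B k) \<in> measurable N (count_space UNIV)" by measurable
  from measurable_compose_countable[OF assms(1) this] show ?thesis
    by (simp add: bid_time_def[abs_def])
qed

lemma places_bid_sets:
  assumes S [measurable]: "\<And>k. S k \<in> borel_measurable N" and B [measurable]: "\<And>k. B k \<in> sets N"
    and [measurable]: "D \<in> sets N"
  shows "{\<omega> \<in> space N. places_bid T d S B D \<omega> \<and> bid_time S B \<omega> \<le> t} \<in> sets N"
    and "{\<omega> \<in> space N. places_bid T d S B D \<omega>} \<in> sets N"
proof -
  note [measurable] = bid_time_measurable[OF S B]
  show "{\<omega> \<in> space N. places_bid T d S B D \<omega> \<and> bid_time S B \<omega> \<le> t} \<in> sets N"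
    "{\<omega> \<in> space N. places_bid T d S B D \<omega>} \<in> sets N"
    unfolding places_bid_def by measurable
qed

context bidder
begin

section \<open>The law of the bid time given the information at arrival\<close>

definition no_bid :: "nat \<Rightarrow> 'a set" where
  "no_bid k = space M - (\<Union>j<k. B j)"

lemma no_bid_0 [simp]: "no_bid 0 = space M"
  by (simp add: no_bid_def)

lemma no_bid_FB: "no_bid k \<in> sets (FB k)"
  unfolding no_bid_def using sets.top[of "FB k"] B_FB by (intro sets.Diff sets.finite_UN) auto

lemma no_bid_sets [measurable]: "no_bid k \<in> sets M"
  unfolding no_bid_def by measurable

lemma G_sets [measurable]: "G \<in> sets M"
  using G_FB subalgebras(2)[of 0] by (auto simp: subalgebra_def)

lemma bid_time_measurable' [measurable]: "bid_time S B \<in> borel_measurable M"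
  by (rule bid_time_measurable) simp_all

lemma integrable_times_bounded:
  fixes Z f :: "'a \<Rightarrow> real"
  assumes "Z \<in> borel_measurable M" "f \<in> borel_measurable M"
    and Z: "\<And>\<omega>. \<omega> \<in> space M \<Longrightarrow> \<bar>Z \<omega>\<bar> \<le> C" and f: "\<And>\<omega>. \<omega> \<in> space M \<Longrightarrow> \<bar>f \<omega>\<bar> \<le> 1"
  shows "integrable M (\<lambda>\<omega>. Z \<omega> * f \<omega>)"
proof (rule integrable_const_bound[of _ C])
  have "norm (Z \<omega> * f \<omega>) \<le> C" if "\<omega> \<in> space M" for \<omega>
    using mult_mono[OF Z[OF that] f[OF that]] Z[OF that] by (simp add: abs_mult)
  then show "AE \<omega> in M. norm (Z \<omega> * f \<omega>) \<le> C" by (rule AE_I2)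
qed (use assms in measurable)

text \<open>Since \<open>\<alpha>\<^sub>2 \<le> \<alpha>\<^sub>3\<close>, each decision is to bid
  with conditional probability at least \<open>\<alpha>\<^sub>2\<close>, wherever the potential bid
  time lies.\<close>

lemma prob_no_bid: "prob (G \<inter> no_bid k) \<le> (1 - \<alpha>\<^sub>2) ^ k"
proof (induction k)
  case (Suc k)
  let ?Z = "indicator (G \<inter> no_bid k) :: 'a \<Rightarrow> real"
  have "G \<inter> no_bid k \<in> sets (FB k)"
    using G_FB FB_mono[of 0 k] no_bid_FB[of k] by auto
  then have Z: "?Z \<in> borel_measurable (FB k)" by simp
  have "\<alpha>\<^sub>2 * prob (G \<inter> no_bid k) = expectation (\<lambda>\<omega>. ?Z \<omega> * \<alpha>\<^sub>2)"
    by simp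
  also have "\<dots> \<le> expectation (\<lambda>\<omega>. ?Z \<omega> * bid_prob (S k \<omega>))"
  proof (rule integral_mono)
    show "integrable M (\<lambda>\<omega>. ?Z \<omega> * \<alpha>\<^sub>2)" "integrable M (\<lambda>\<omega>. ?Z \<omega> * bid_prob (S k \<omega>))"
      using \<alpha>\<^sub>2_pos \<alpha>\<^sub>2_le \<alpha>\<^sub>3_le bid_prob_bounds
      by (intro integrable_times_bounded[where C = 1]; simp add: abs_of_pos)+
    show "?Z \<omega> * \<alpha>\<^sub>2 \<le> ?Z \<omega> * bid_prob (S k \<omega>)" for \<omega>
      using bid_prob_bounds(1) by (intro mult_left_mono) auto
  qed
  also have "\<dots> = expectation (\<lambda>\<omega>. ?Z \<omega> * indicator (B k) \<omega>)"
    by (rule expectation_bid[OF Z, of 1, symmetric]) (auto simp: no_bid_def indicator_def)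
  also have "\<dots> = prob (G \<inter> no_bid k \<inter> B k)"
    by (simp add: indicator_inter_arith[symmetric] Int_assoc)
  finally have "\<alpha>\<^sub>2 * prob (G \<inter> no_bid k) \<le> prob (G \<inter> no_bid k \<inter> B k)" .
  moreover have "prob (G \<inter> no_bid (Suc k)) = prob (G \<inter> no_bid k) - prob (G \<inter> no_bid k \<inter> B k)"
  proof -
    have "G \<inter> no_bid (Suc k) = (G \<inter> no_bid k) - (G \<inter> no_bid k \<inter> B k)"
      by (auto simp: no_bid_def less_Suc_eq)
    then show ?thesis by (simp add: finite_measure_Diff[OF _ _ Int_lower1])
  qed
  ultimately have "prob (G \<inter> no_bid (Suc k)) \<le> (1 - \<alpha>\<^sub>2) * prob (G \<inter> no_bid k)"
    by (simp add: algebra_simps)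
  also have "\<dots> \<le> (1 - \<alpha>\<^sub>2) * (1 - \<alpha>\<^sub>2) ^ k"
    using Suc \<alpha>\<^sub>2_le \<alpha>\<^sub>3_le by (intro mult_left_mono) auto
  finally show ?case by simp
qed simp

text \<open>The geometric bound tends to 0. Departing bidders are included, because departure does
  not interrupt the sequence of decisions in this encoding; \<open>D\<close> merely invalidates a
  late bid.\<close>

lemma AE_bids: "AE \<omega> in M. \<omega> \<in> G \<longrightarrow> (\<exists>k. \<omega> \<in> B k)"
proof -
  have "(\<lambda>k. (1 - \<alpha>\<^sub>2) ^ k) \<longlonglongrightarrow> 0"
    using \<alpha>\<^sub>2_pos \<alpha>\<^sub>2_le \<alpha>\<^sub>3_le by (intro LIMSEQ_realpow_zero) auto
  moreover have "prob (G - (\<Union>k. B k)) \<le> (1 - \<alpha>\<^sub>2) ^ k" for k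
  proof -
    have "G - (\<Union>k. B k) \<subseteq> G \<inter> no_bid k"
      using sets.sets_into_space[OF G_sets] by (auto simp: no_bid_def)
    then have "prob (G - (\<Union>k. B k)) \<le> prob (G \<inter> no_bid k)" by (intro finite_measure_mono) auto
    then show ?thesis using prob_no_bid[of k] by simp
  qed
  ultimately have "prob (G - (\<Union>k. B k)) \<le> 0"
    by (intro LIMSEQ_le_const) auto
  then have "prob (G - (\<Union>k. B k)) = 0" by (intro antisym measure_nonneg)
  then have "AE \<omega> in M. \<omega> \<notin> G - (\<Union>k. B k)" by (subst (asm) prob_eq_0) auto
  then show ?thesis by (auto elim!: eventually_mono)
qed

lemma bid_time_eq:
  assumes "\<omega> \<in> no_bid k" "\<omega> \<in> B k"
  shows "bid_time S B \<omega> = S k \<omega>"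
proof -
  have "(LEAST j. \<omega> \<in> B j) = k"
    using assms by (intro Least_equality) (auto simp: no_bid_def not_less[symmetric])
  then show ?thesis by (simp add: bid_time_def)
qed

text \<open>
  Replacing the events after the first \<open>k\<close> decisions by their conditional probability
  \<open>surv_at t (S k)\<close> does not change expectations, and a bid is almost surely placed after
  finitely many decisions.
\<close>

lemma expectation_later:
  assumes Z: "Z \<in> borel_measurable (FB 0)" and bound: "\<And>\<omega>. \<omega> \<in> space M \<Longrightarrow> 0 \<le> Z \<omega> \<and> Z \<omega> \<le> C"
    and zero: "\<And>\<omega>. \<omega> \<in> space M \<Longrightarrow> \<omega> \<notin> G \<Longrightarrow> Z \<omega> = 0"
    and t: "t \<le> T"
  shows "expectation (\<lambda>\<omega>. Z \<omega> * of_bool (t < bid_time S B \<omega>)) = expectation (\<lambda>\<omega>. Z \<omega> * surv_at t (S 0 \<omega>))"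
proof -
  have Z_M [measurable]: "Z \<in> borel_measurable M"
    using measurable_from_subalg[OF subalgebras(2) Z] .
  have int: "integrable M (\<lambda>\<omega>. Z \<omega> * f \<omega>)" if "f \<in> borel_measurable M" "\<And>\<omega>. \<bar>f \<omega>\<bar> \<le> 1" for f
    by (rule integrable_times_bounded[where C = C, OF Z_M that(1)]) (use bound that(2) in auto)
  have H: "\<bar>surv_at t x\<bar> \<le> 1" and A: "\<bar>surv_after t x\<bar> \<le> 1" and bp: "\<bar>bid_prob x\<bar> \<le> 1" for x
    using surv_at_bounds[OF t, of x] surv_after_bounds[OF t, of x] bid_prob_bounds[of x] by auto
  \<comment> \<open>\<open>V\<close> is a martingale: \<open>V k\<close> is the conditional
    probability of \<open>t < bid_time S B \<omega>\<close> after \<open>k\<close> decisions, hence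
    0 or 1 as soon as one of them was to bid.\<close>
  define V where "V k \<omega> = (if \<omega> \<in> no_bid k then surv_at t (S k \<omega>) else of_bool (t < bid_time S B \<omega>))" for k \<omega>
  have V_meas [measurable]: "V k \<in> borel_measurable M" for k unfolding V_def[abs_def] by measurable
  have V_bound: "\<bar>V k \<omega>\<bar> \<le> 1" for k \<omega> using H by (simp add: V_def)
  have step: "expectation (\<lambda>\<omega>. Z \<omega> * V (Suc k) \<omega>) = expectation (\<lambda>\<omega>. Z \<omega> * V k \<omega>)" for k
  proof -
    let ?N = "\<lambda>\<omega>. indicator (no_bid k) \<omega> :: real" and ?B = "\<lambda>\<omega>. indicator (B k) \<omega> :: real"
    define L where "L \<omega> = (of_bool (t < S k \<omega>) :: real)" for \<omega>
    define A' where "A' \<omega> = surv_after t (S k \<omega>)" for \<omega>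
    define b where "b \<omega> = bid_prob (S k \<omega>)" for \<omega>
    note defs = L_def A'_def b_def
    have Z_FB: "Z \<in> borel_measurable (FB k)"
      by (rule measurable_from_larger[OF Z]) (use FB_mono[of 0 k] in auto)
    note [measurable] = S_FB[of k] no_bid_FB[of k]
    have [measurable]: "L \<in> borel_measurable M" "A' \<in> borel_measurable M" "b \<in> borel_measurable M"
      unfolding defs by measurable
    have bid: "expectation (\<lambda>\<omega>. (Z \<omega> * (?N \<omega> * f (S k \<omega>))) * ?B \<omega>) = expectation (\<lambda>\<omega>. (Z \<omega> * (?N \<omega> * f (S k \<omega>))) * b \<omega>)"
      if [measurable]: "f \<in> borel_measurable borel" and f: "\<And>x. \<bar>f x\<bar> \<le> 1" for f :: "real \<Rightarrow> real"
      unfolding b_def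
    proof (rule expectation_bid)
      show "(\<lambda>\<omega>. Z \<omega> * (?N \<omega> * f (S k \<omega>))) \<in> borel_measurable (FB k)"
        using Z_FB by measurable
      show "\<bar>Z \<omega> * (?N \<omega> * f (S k \<omega>))\<bar> \<le> C" if "\<omega> \<in> space M" for \<omega>
        using mult_mono[of "Z \<omega>" C "\<bar>?N \<omega> * f (S k \<omega>)\<bar>" 1] bound[OF that] f[of "S k \<omega>"]
        by (auto simp: abs_mult indicator_def)
      show "Z \<omega> * (?N \<omega> * f (S k \<omega>)) = 0" if "\<omega> \<in> space M" "\<omega> \<notin> G - (\<Union>j<k. B j)" for \<omega>
        using zero[of \<omega>] that by (cases "\<omega> \<in> G") (auto simp: no_bid_def indicator_def)
    qed
    have "expectation (\<lambda>\<omega>. (Z \<omega> * (?N \<omega> * (1 - ?B \<omega>))) * surv_at t (S (Suc k) \<omega>))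
        = expectation (\<lambda>\<omega>. (Z \<omega> * (?N \<omega> * (1 - ?B \<omega>))) * surv_after t (S k \<omega>))"
    proof (rule expectation_next[OF _ _ _ t])
      have [measurable]: "no_bid k \<in> sets (FS k)" "B k \<in> sets (FS k)"
        using no_bid_FB FB_subset_FS B_FS by auto
      have "Z \<in> borel_measurable (FS k)"
        by (rule measurable_from_larger[OF Z_FB]) (use FB_subset_FS in auto)
      then show "(\<lambda>\<omega>. Z \<omega> * (?N \<omega> * (1 - ?B \<omega>))) \<in> borel_measurable (FS k)"
        by measurable
      show "0 \<le> Z \<omega> * (?N \<omega> * (1 - ?B \<omega>)) \<and> Z \<omega> * (?N \<omega> * (1 - ?B \<omega>)) \<le> C" if "\<omega> \<in> space M" for \<omega>
        using bound[OF that] by (auto simp: indicator_def)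
      show "Z \<omega> * (?N \<omega> * (1 - ?B \<omega>)) = 0" if "\<omega> \<in> space M" "\<omega> \<notin> G - (\<Union>j\<le>k. B j)" for \<omega>
        using zero[of \<omega>] that by (auto simp: no_bid_def indicator_def le_less)
    qed
    then have later_step: "expectation (\<lambda>\<omega>. Z \<omega> * (?N \<omega> * (1 - ?B \<omega>) * surv_at t (S (Suc k) \<omega>)))
        = expectation (\<lambda>\<omega>. Z \<omega> * (?N \<omega> * (1 - ?B \<omega>) * A' \<omega>))"
      by (simp add: A'_def mult.assoc)
    have L': "expectation (\<lambda>\<omega>. Z \<omega> * (?N \<omega> * L \<omega> * ?B \<omega>)) = expectation (\<lambda>\<omega>. Z \<omega> * (?N \<omega> * L \<omega> * b \<omega>))"
      using bid[of "\<lambda>x. of_bool (t < x)"] by (simp add: L_def mult.assoc)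
    have A'': "expectation (\<lambda>\<omega>. Z \<omega> * (?N \<omega> * A' \<omega> * ?B \<omega>)) = expectation (\<lambda>\<omega>. Z \<omega> * (?N \<omega> * A' \<omega> * b \<omega>))"
      using bid[of "surv_after t"] A by (simp add: A'_def mult.assoc)
    have bounds: "\<bar>L \<omega>\<bar> \<le> 1" "\<bar>A' \<omega>\<bar> \<le> 1" "\<bar>b \<omega>\<bar> \<le> 1" "\<bar>?N \<omega>\<bar> \<le> 1" "\<bar>?B \<omega>\<bar> \<le> 1" "\<bar>1 - ?B \<omega>\<bar> \<le> 1" for \<omega>
      using A bp by (auto simp: defs indicator_def)
    have I: "integrable M (\<lambda>\<omega>. Z \<omega> * (x \<omega> * y \<omega> * z \<omega>))"
      if [measurable]: "x \<in> borel_measurable M" "y \<in> borel_measurable M" "z \<in> borel_measurable M"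
        and "\<And>\<omega>. \<bar>x \<omega>\<bar> \<le> 1" "\<And>\<omega>. \<bar>y \<omega>\<bar> \<le> 1" "\<And>\<omega>. \<bar>z \<omega>\<bar> \<le> 1" for x y z
      using that(4-6) by (intro int) (auto simp: abs_mult mult_le_one)
    have ints: "integrable M (\<lambda>\<omega>. Z \<omega> * (?N \<omega> * L \<omega> * ?B \<omega>))" "integrable M (\<lambda>\<omega>. Z \<omega> * (?N \<omega> * L \<omega> * b \<omega>))"
      "integrable M (\<lambda>\<omega>. Z \<omega> * (?N \<omega> * A' \<omega> * ?B \<omega>))" "integrable M (\<lambda>\<omega>. Z \<omega> * (?N \<omega> * A' \<omega> * b \<omega>))"
      "integrable M (\<lambda>\<omega>. Z \<omega> * (?N \<omega> * (1 - ?B \<omega>) * A' \<omega>))"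
      "integrable M (\<lambda>\<omega>. Z \<omega> * (?N \<omega> * (1 - ?B \<omega>) * surv_at t (S (Suc k) \<omega>)))"
      by (rule I; (simp add: bounds H)?; measurable)+
    note ints = ints int[OF V_meas V_bound]
    have "expectation (\<lambda>\<omega>. Z \<omega> * V (Suc k) \<omega>) - expectation (\<lambda>\<omega>. Z \<omega> * V k \<omega>)
        = expectation (\<lambda>\<omega>. Z \<omega> * V (Suc k) \<omega> - Z \<omega> * V k \<omega>)"
      using ints by simp
    \<comment> \<open>The term \<open>(1 - b) * A'\<close> is written as
      \<open>(1 - B) * A' + A' * B - A' * b\<close>, with \<open>B\<close> for the indicator of the
      decision to bid. The differences then cancel in pairs by \<open>L'\<close>,
      \<open>later_step\<close> and \<open>A''\<close>.\<close>
    also have "\<dots> = expectation (\<lambda>\<omega>. Z \<omega> * (?N \<omega> * L \<omega> * ?B \<omega>)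
        + Z \<omega> * (?N \<omega> * (1 - ?B \<omega>) * surv_at t (S (Suc k) \<omega>))
        - (Z \<omega> * (?N \<omega> * L \<omega> * b \<omega>) + Z \<omega> * (?N \<omega> * (1 - ?B \<omega>) * A' \<omega>)
          + Z \<omega> * (?N \<omega> * A' \<omega> * ?B \<omega>) - Z \<omega> * (?N \<omega> * A' \<omega> * b \<omega>)))"
    proof (intro Bochner_Integration.integral_cong refl)
      fix \<omega> assume \<omega>: "\<omega> \<in> space M"
      have H_eq: "surv_at t (S k \<omega>) = b \<omega> * L \<omega> + (1 - b \<omega>) * A' \<omega>"
        by (simp add: surv_at_def defs)
      have "V (Suc k) \<omega> - V k \<omega> = ?N \<omega> * (L \<omega> * ?B \<omega> + (1 - ?B \<omega>) * surv_at t (S (Suc k) \<omega>) - surv_at t (S k \<omega>))"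
      proof (cases "\<omega> \<in> no_bid k")
        case N: True
        show ?thesis
        proof (cases "\<omega> \<in> B k")
          case True
          then have "\<omega> \<notin> no_bid (Suc k)" by (auto simp: no_bid_def)
          then show ?thesis using N True bid_time_eq[OF N True] by (simp add: V_def L_def)
        next
          case False
          then have "\<omega> \<in> no_bid (Suc k)" using N by (auto simp: no_bid_def less_Suc_eq)
          then show ?thesis using N False by (simp add: V_def)
        qed
      next
        case False
        then have "\<omega> \<notin> no_bid (Suc k)" using \<omega> by (auto simp: no_bid_def)
        then show ?thesis using False by (simp add: V_def)
      qed
      then have "Z \<omega> * V (Suc k) \<omega> - Z \<omega> * V k \<omega>
          = Z \<omega> * (?N \<omega> * (L \<omega> * ?B \<omega> + (1 - ?B \<omega>) * surv_at t (S (Suc k) \<omega>) - surv_at t (S k \<omega>)))"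
        by (simp add: right_diff_distrib[symmetric])
      then show "Z \<omega> * V (Suc k) \<omega> - Z \<omega> * V k \<omega> = Z \<omega> * (?N \<omega> * L \<omega> * ?B \<omega>)
        + Z \<omega> * (?N \<omega> * (1 - ?B \<omega>) * surv_at t (S (Suc k) \<omega>))
        - (Z \<omega> * (?N \<omega> * L \<omega> * b \<omega>) + Z \<omega> * (?N \<omega> * (1 - ?B \<omega>) * A' \<omega>)
          + Z \<omega> * (?N \<omega> * A' \<omega> * ?B \<omega>) - Z \<omega> * (?N \<omega> * A' \<omega> * b \<omega>))"
        unfolding H_eq by (simp add: algebra_simps)
    qed
    also have "\<dots> = 0"
      using ints later_step L' A'' by simp
    finally show ?thesis by simp
  qed
  have "expectation (\<lambda>\<omega>. Z \<omega> * V k \<omega>) = expectation (\<lambda>\<omega>. Z \<omega> * V 0 \<omega>)" for k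
    by (induction k) (simp_all add: step)
  also have "expectation (\<lambda>\<omega>. Z \<omega> * V 0 \<omega>) = expectation (\<lambda>\<omega>. Z \<omega> * surv_at t (S 0 \<omega>))"
    by (intro Bochner_Integration.integral_cong) (simp_all add: V_def)
  finally have const: "expectation (\<lambda>\<omega>. Z \<omega> * V k \<omega>) = expectation (\<lambda>\<omega>. Z \<omega> * surv_at t (S 0 \<omega>))" for k .
  have "(\<lambda>k. expectation (\<lambda>\<omega>. Z \<omega> * V k \<omega>)) \<longlonglongrightarrow> expectation (\<lambda>\<omega>. Z \<omega> * of_bool (t < bid_time S B \<omega>))"
  proof (rule integral_dominated_convergence[where w = "\<lambda>_. C"])
    show "AE \<omega> in M. (\<lambda>k. Z \<omega> * V k \<omega>) \<longlonglongrightarrow> Z \<omega> * of_bool (t < bid_time S B \<omega>)"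
      using AE_bids AE_space
    proof eventually_elim
      case (elim \<omega>)
      show ?case
      proof (cases "\<omega> \<in> G")
        case True
        then obtain j where j: "\<omega> \<in> B j" using elim by auto
        have "\<forall>\<^sub>F k in sequentially. Z \<omega> * V k \<omega> = Z \<omega> * of_bool (t < bid_time S B \<omega>)"
          using eventually_gt_at_top[of j] by eventually_elim (use j in \<open>auto simp: V_def no_bid_def\<close>)
        then show ?thesis by (rule tendsto_eventually)
      next
        case False
        then show ?thesis using zero elim by simp
      qed
    qed
    have "norm (Z \<omega> * V k \<omega>) \<le> C" if "\<omega> \<in> space M" for \<omega> k
      using mult_mono[of "Z \<omega>" C "\<bar>V k \<omega>\<bar>" 1] bound[OF that] V_bound[of k \<omega>] by (simp add: abs_mult)
    then show "AE \<omega> in M. norm (Z \<omega> * V k \<omega>) \<le> C" for k by (rule AE_I2)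
  qed simp_all
  then show ?thesis unfolding const by (simp add: LIMSEQ_const_iff)
qed

text \<open>A bid by \<open>t\<close> is placed if it is decided by
  \<open>m = min t (T - d)\<close>, or between \<open>m\<close> and \<open>t\<close> by a bidder
  outside \<open>D\<close>. As \<open>D\<close> belongs to \<open>FB 0\<close>, it is absorbed into
  the test factor \<open>ZD\<close>, and \<open>expectation_later\<close> applies. Only then is
  \<open>D\<close> averaged out, at the level of \<open>FD\<close>, with the factor
  \<open>\<alpha>\<^sub>2 / \<alpha>\<^sub>3\<close>.\<close>

lemma expectation_placed:
  assumes Z: "Z \<in> borel_measurable FD" and bound: "\<And>\<omega>. \<omega> \<in> space M \<Longrightarrow> 0 \<le> Z \<omega> \<and> Z \<omega> \<le> C"
    and zero: "\<And>\<omega>. \<omega> \<in> space M \<Longrightarrow> \<omega> \<notin> G \<Longrightarrow> Z \<omega> = 0"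
    and t: "t \<le> T"
  shows "expectation (\<lambda>\<omega>. Z \<omega> * of_bool (places_bid T d S B D \<omega> \<and> bid_time S B \<omega> \<le> t))
    = expectation (\<lambda>\<omega>. Z \<omega> * placed_at t (S 0 \<omega>))"
proof -
  define m where "m = min t (T - d)"
  have m: "m \<le> T" using t by (simp add: m_def)
  define L where "L s \<omega> = (of_bool (s < bid_time S B \<omega>) :: real)" for s \<omega>
  define ZD where "ZD \<omega> = Z \<omega> * (1 - indicator D \<omega>)" for \<omega>
  have Z_FB: "Z \<in> borel_measurable (FB 0)"
    by (rule measurable_from_larger[OF Z]) (use FD_subset_FB in auto)
  have ZD_FB: "ZD \<in> borel_measurable (FB 0)"
  proof -
    note [measurable] = D_FB Z_FB
    show ?thesis unfolding ZD_def[abs_def] by measurable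
  qed
  have Z_M [measurable]: "Z \<in> borel_measurable M"
    using measurable_from_subalg[OF subalgebras(1) Z] .
  have ZD_M [measurable]: "ZD \<in> borel_measurable M"
    unfolding ZD_def[abs_def] by measurable
  have L_M [measurable]: "L s \<in> borel_measurable M" for s
    unfolding L_def[abs_def] by measurable
  have int: "integrable M (\<lambda>\<omega>. Z \<omega> * f \<omega>)" if "f \<in> borel_measurable M" "\<And>\<omega>. \<bar>f \<omega>\<bar> \<le> 1" for f
    by (rule integrable_times_bounded[where C = C, OF Z_M that(1)]) (use bound that(2) in auto)
  have int_D: "integrable M (\<lambda>\<omega>. ZD \<omega> * f \<omega>)" if f: "f \<in> borel_measurable M" "\<And>\<omega>. \<bar>f \<omega>\<bar> \<le> 1" for f
  proof (rule integrable_times_bounded[where C = C, OF ZD_M f(1) _ f(2)])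
    show "\<bar>ZD \<omega>\<bar> \<le> C" if "\<omega> \<in> space M" for \<omega>
      using bound[OF that] by (auto simp: ZD_def indicator_def)
  qed
  have later: "expectation (\<lambda>\<omega>. Z \<omega> * L s \<omega>) = expectation (\<lambda>\<omega>. Z \<omega> * surv_at s (S 0 \<omega>))"
    if "s \<le> T" for s
    unfolding L_def by (rule expectation_later[OF Z_FB bound zero that])
  have depart: "expectation (\<lambda>\<omega>. ZD \<omega> * L s \<omega>) = (\<alpha>\<^sub>2 / \<alpha>\<^sub>3) * expectation (\<lambda>\<omega>. Z \<omega> * surv_at s (S 0 \<omega>))"
    if s: "s \<le> T" for s
  proof -
    have H: "\<bar>surv_at s x\<bar> \<le> 1" for x using surv_at_bounds[OF s, of x] by simp
    have "expectation (\<lambda>\<omega>. ZD \<omega> * L s \<omega>) = expectation (\<lambda>\<omega>. ZD \<omega> * surv_at s (S 0 \<omega>))"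
      unfolding L_def
    proof (rule expectation_later[OF ZD_FB _ _ s])
      show "0 \<le> ZD \<omega> \<and> ZD \<omega> \<le> C" if "\<omega> \<in> space M" for \<omega>
        using bound[OF that] by (auto simp: ZD_def indicator_def)
      show "ZD \<omega> = 0" if "\<omega> \<in> space M" "\<omega> \<notin> G" for \<omega>
        using zero[OF that] by (simp add: ZD_def)
    qed
    also have "\<dots> = expectation (\<lambda>\<omega>. Z \<omega> * surv_at s (S 0 \<omega>) - Z \<omega> * surv_at s (S 0 \<omega>) * indicator D \<omega>)"
      by (intro Bochner_Integration.integral_cong) (simp_all add: ZD_def algebra_simps)
    also have "\<dots> = expectation (\<lambda>\<omega>. Z \<omega> * surv_at s (S 0 \<omega>))
        - expectation (\<lambda>\<omega>. Z \<omega> * surv_at s (S 0 \<omega>) * indicator D \<omega>)"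
    proof (rule Bochner_Integration.integral_diff)
      show "integrable M (\<lambda>\<omega>. Z \<omega> * surv_at s (S 0 \<omega>))" by (rule int) (use H in simp_all)
      have "integrable M (\<lambda>\<omega>. Z \<omega> * (surv_at s (S 0 \<omega>) * indicator D \<omega>))"
        by (rule int) (use H in \<open>simp_all add: indicator_def\<close>)
      then show "integrable M (\<lambda>\<omega>. Z \<omega> * surv_at s (S 0 \<omega>) * indicator D \<omega>)" by (simp add: mult.assoc)
    qed
    also have "expectation (\<lambda>\<omega>. Z \<omega> * surv_at s (S 0 \<omega>) * indicator D \<omega>)
        = expectation (\<lambda>\<omega>. Z \<omega> * surv_at s (S 0 \<omega>) * (1 - \<alpha>\<^sub>2 / \<alpha>\<^sub>3))"
    proof (rule expectation_depart)
      have [measurable]: "S 0 \<in> borel_measurable FD"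
        unfolding FD_def using events_Pow(2) by (intro generated_by_measurable) auto
      note [measurable] = Z
      show "(\<lambda>\<omega>. Z \<omega> * surv_at s (S 0 \<omega>)) \<in> borel_measurable FD" by measurable
      show "\<bar>Z \<omega> * surv_at s (S 0 \<omega>)\<bar> \<le> C" if "\<omega> \<in> space M" for \<omega>
        using mult_mono[of "Z \<omega>" C "\<bar>surv_at s (S 0 \<omega>)\<bar>" 1] bound[OF that] H[of "S 0 \<omega>"] by (simp add: abs_mult)
      show "Z \<omega> * surv_at s (S 0 \<omega>) = 0" if "\<omega> \<in> space M" "\<omega> \<notin> G" for \<omega>
        using zero[OF that] by simp
    qed
    finally show ?thesis unfolding integral_mult_left_zero by (simp add: algebra_simps)
  qed
  have bounds: "\<bar>L s \<omega>\<bar> \<le> 1" for s \<omega> by (simp add: L_def)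
  have H: "\<bar>surv_at s x\<bar> \<le> 1" if "s \<le> T" for s x using surv_at_bounds[OF that, of x] by simp
  have ints: "integrable M Z" "integrable M (\<lambda>\<omega>. Z \<omega> * L s \<omega>)" "integrable M (\<lambda>\<omega>. ZD \<omega> * L s \<omega>)" for s
    using int[of "\<lambda>_. 1"] int[OF L_M bounds] int_D[OF L_M bounds] by simp_all
  have "expectation (\<lambda>\<omega>. Z \<omega> * of_bool (places_bid T d S B D \<omega> \<and> bid_time S B \<omega> \<le> t))
      = expectation (\<lambda>\<omega>. Z \<omega> - Z \<omega> * L m \<omega> + (ZD \<omega> * L m \<omega> - ZD \<omega> * L t \<omega>))"
  proof (rule integral_cong_AE)
    have [measurable]: "{\<omega> \<in> space M. places_bid T d S B D \<omega> \<and> bid_time S B \<omega> \<le> t} \<in> sets M"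
      by (rule places_bid_sets) simp_all
    show "(\<lambda>\<omega>. Z \<omega> * of_bool (places_bid T d S B D \<omega> \<and> bid_time S B \<omega> \<le> t)) \<in> borel_measurable M"
      by measurable
    show "AE \<omega> in M. Z \<omega> * of_bool (places_bid T d S B D \<omega> \<and> bid_time S B \<omega> \<le> t)
        = Z \<omega> - Z \<omega> * L m \<omega> + (ZD \<omega> * L m \<omega> - ZD \<omega> * L t \<omega>)"
      using AE_bids AE_space
    proof eventually_elim
      case (elim \<omega>)
      show ?case
      proof (cases "\<omega> \<in> G")
        case True
        then have "\<exists>k. \<omega> \<in> B k" using elim by blast
        then show ?thesis by (auto simp: places_bid_def L_def ZD_def m_def indicator_def)
      next
        case False
        then have "Z \<omega> = 0" using zero elim by blast
        then show ?thesis by (simp add: ZD_def)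
      qed
    qed
  qed measurable
  also have "\<dots> = expectation Z - expectation (\<lambda>\<omega>. Z \<omega> * surv_at m (S 0 \<omega>))
      + (\<alpha>\<^sub>2 / \<alpha>\<^sub>3) * (expectation (\<lambda>\<omega>. Z \<omega> * surv_at m (S 0 \<omega>)) - expectation (\<lambda>\<omega>. Z \<omega> * surv_at t (S 0 \<omega>)))"
    using ints by (simp add: later[OF m] depart[OF m] depart[OF t] right_diff_distrib)
  also have "\<dots> = expectation (\<lambda>\<omega>. Z \<omega> - Z \<omega> * surv_at m (S 0 \<omega>)
      + (\<alpha>\<^sub>2 / \<alpha>\<^sub>3) * (Z \<omega> * surv_at m (S 0 \<omega>) - Z \<omega> * surv_at t (S 0 \<omega>)))"
  proof -
    have "integrable M (\<lambda>\<omega>. Z \<omega> * surv_at s (S 0 \<omega>))" if "s \<le> T" for s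
      by (rule int) (use H[OF that] in simp_all)
    from this[OF m] this[OF t] ints(1) show ?thesis by simp
  qed
  also have "\<dots> = expectation (\<lambda>\<omega>. Z \<omega> * placed_at t (S 0 \<omega>))"
    by (intro Bochner_Integration.integral_cong) (simp_all add: placed_at_def m_def algebra_simps)
  finally show ?thesis .
qed

end

subsection \<open>Generating functions of Poisson variables\<close>

text \<open>When all lower coefficients vanish, the series can be divided by \<open>z ^ n\<close>,
  and its limit at 0 is \<open>c n\<close>. The hypothesis concerns positive \<open>z\<close> only,
  so the limit is taken from the right.\<close>

lemma powser_zero_on_unit_interval:
  fixes c :: "nat \<Rightarrow> real"
  assumes zero: "\<And>z. 0 < z \<Longrightarrow> z < 1 \<Longrightarrow> (\<lambda>n. c n * z ^ n) sums 0"
  shows "c n = 0"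
proof (induction n rule: less_induct)
  case (less n)
  define b where "b i = c (i + n)" for i
  have sums: "(\<lambda>i. b i * z ^ i) sums 0" if z: "0 < z" "z < 1" for z
  proof -
    have "(\<lambda>i. c (i + n) * z ^ (i + n)) sums (0 - (\<Sum>i<n. c i * z ^ i))"
      by (rule sums_split_initial_segment[OF zero[OF z]])
    then have "(\<lambda>i. c (i + n) * z ^ (i + n) / z ^ n) sums (0 / z ^ n)"
      using less by (intro sums_divide) simp
    then show ?thesis using z by (simp add: b_def power_add)
  qed
  have "((\<lambda>x. \<Sum>i. b i * x ^ i) \<longlongrightarrow> b 0) (at 0)"
  proof (rule powser_limit_0)
    show "(\<lambda>i. b i * x ^ i) sums (\<Sum>i. b i * x ^ i)" if "norm x < 1 / 2" for x
      by (rule summable_sums, rule powser_inside[of b "1/2"])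
        (use that sums[of "1/2"] in \<open>auto simp: sums_iff\<close>)
  qed simp
  then have "((\<lambda>x. \<Sum>i. b i * x ^ i) \<longlongrightarrow> b 0) (at_right 0)"
    by (rule tendsto_within_subset) simp
  moreover have "((\<lambda>x. \<Sum>i. b i * x ^ i) \<longlongrightarrow> 0) (at_right 0)"
    by (rule tendsto_eventually, unfold eventually_at_right_field)
      (use sums in \<open>auto simp: sums_iff intro!: exI[of _ 1]\<close>)
  ultimately have "b 0 = 0"
    by (rule tendsto_unique[rotated]) simp
  then show ?case by (simp add: b_def)
qed

definition poisson_prob :: "real \<Rightarrow> nat \<Rightarrow> real" where
  "poisson_prob m n = m ^ n / fact n * exp (- m)"

lemma poisson_pgf_sums: "(\<lambda>n. poisson_prob m n * z ^ n) sums exp (- ((1 - z) * m))"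
proof -
  have "(\<lambda>n. (z * m) ^ n /\<^sub>R fact n * exp (- m)) sums (exp (z * m) * exp (- m))"
    by (intro sums_mult2 exp_converges)
  also have "(\<lambda>n. (z * m) ^ n /\<^sub>R fact n * exp (- m)) = (\<lambda>n. poisson_prob m n * z ^ n)"
    by (auto simp: poisson_prob_def power_mult_distrib field_simps)
  also have "exp (z * m) * exp (- m) = exp (- ((1 - z) * m))"
    by (simp add: algebra_simps flip: exp_add)
  finally show ?thesis .
qed

context prob_space
begin

lemma expectation_sums_nat:
  fixes F :: "nat \<Rightarrow> 'a \<Rightarrow> real"
  assumes [measurable]: "X \<in> measurable M (count_space UNIV)" "\<And>n. F n \<in> borel_measurable M"
    and bound: "\<And>n \<omega>. \<omega> \<in> space M \<Longrightarrow> \<bar>F n \<omega>\<bar> \<le> C"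
  shows "(\<lambda>n. expectation (\<lambda>\<omega>. F n \<omega> * of_bool (X \<omega> = n))) sums expectation (\<lambda>\<omega>. F (X \<omega>) \<omega>)"
proof -
  obtain \<omega>\<^sub>0 where "\<omega>\<^sub>0 \<in> space M" using not_empty by auto
  then have "0 \<le> C" using bound[of \<omega>\<^sub>0 0] by simp
  then have int: "integrable M (\<lambda>\<omega>. F n \<omega> * of_bool (X \<omega> = n))" for n
    by (intro integrable_const_bound[of _ C]) (use bound in \<open>auto intro!: AE_I2\<close>)
  have eq: "(\<Sum>n<N. F n \<omega> * of_bool (X \<omega> = n)) = F (X \<omega>) \<omega> * of_bool (X \<omega> < N)" for N \<omega>
    by (induction N) (auto simp: less_Suc_eq)
  have "(\<lambda>N. expectation (\<lambda>\<omega>. F (X \<omega>) \<omega> * of_bool (X \<omega> < N))) \<longlonglongrightarrow> expectation (\<lambda>\<omega>. F (X \<omega>) \<omega>)"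
  proof (rule integral_dominated_convergence[where w = "\<lambda>_. C"])
    show "(\<lambda>\<omega>. F (X \<omega>) \<omega>) \<in> borel_measurable M"
      by (rule measurable_compose_countable[OF assms(2,1)])
    then show "(\<lambda>\<omega>. F (X \<omega>) \<omega> * of_bool (X \<omega> < N)) \<in> borel_measurable M" for N by measurable
    show "AE \<omega> in M. (\<lambda>N. F (X \<omega>) \<omega> * of_bool (X \<omega> < N)) \<longlonglongrightarrow> F (X \<omega>) \<omega>"
    proof (rule AE_I2)
      fix \<omega>
      have "\<forall>\<^sub>F N in sequentially. F (X \<omega>) \<omega> * of_bool (X \<omega> < N) = F (X \<omega>) \<omega>"
        using eventually_gt_at_top[of "X \<omega>"] by eventually_elim simp
      then show "(\<lambda>N. F (X \<omega>) \<omega> * of_bool (X \<omega> < N)) \<longlonglongrightarrow> F (X \<omega>) \<omega>" by (rule tendsto_eventually)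
    qed
    show "AE \<omega> in M. norm (F (X \<omega>) \<omega> * of_bool (X \<omega> < N)) \<le> C" for N
      using bound \<open>0 \<le> C\<close> by (intro AE_I2) simp
  qed simp
  then show ?thesis
    unfolding sums_def using int by (simp add: eq flip: Bochner_Integration.integral_sum)
qed

text \<open>Both sides are the coefficients of one power series in \<open>z\<close>. The factor
  \<open>Y\<close> allows a joint generating function to be inverted in one variable while the
  others are held fixed.\<close>

lemma expectation_of_bool_eq_if_pgf_eq:
  fixes a :: "nat \<Rightarrow> real" and Y :: "'a \<Rightarrow> real"
  assumes [measurable]: "X \<in> measurable M (count_space UNIV)" "Y \<in> borel_measurable M"
    and bound: "\<And>\<omega>. \<omega> \<in> space M \<Longrightarrow> \<bar>Y \<omega>\<bar> \<le> C"
    and pgf: "\<And>z. 0 < z \<Longrightarrow> z < 1 \<Longrightarrow> (\<lambda>n. a n * z ^ n) sums expectation (\<lambda>\<omega>. Y \<omega> * z ^ X \<omega>)"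
  shows "expectation (\<lambda>\<omega>. Y \<omega> * of_bool (X \<omega> = n)) = a n"
proof -
  have "a n - expectation (\<lambda>\<omega>. Y \<omega> * of_bool (X \<omega> = n)) = 0"
  proof (rule powser_zero_on_unit_interval[where c = "\<lambda>n. a n - expectation (\<lambda>\<omega>. Y \<omega> * of_bool (X \<omega> = n))"])
    fix z :: real assume z: "0 < z" "z < 1"
    have "\<bar>Y \<omega> * z ^ n\<bar> \<le> C" if "\<omega> \<in> space M" for \<omega> n
      using mult_mono[OF bound[OF that] power_le_one[of z n]] z abs_ge_zero[of "Y \<omega>"] bound[OF that]
      by (simp add: abs_mult)
    then have "(\<lambda>n. expectation (\<lambda>\<omega>. Y \<omega> * z ^ n * of_bool (X \<omega> = n))) sums
        expectation (\<lambda>\<omega>. Y \<omega> * z ^ X \<omega>)"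
      by (intro expectation_sums_nat[where C = C]) auto
    moreover have "expectation (\<lambda>\<omega>. Y \<omega> * z ^ n * of_bool (X \<omega> = n))
        = expectation (\<lambda>\<omega>. Y \<omega> * of_bool (X \<omega> = n)) * z ^ n" for n
    proof -
      have "(\<lambda>\<omega>. Y \<omega> * z ^ n * of_bool (X \<omega> = n)) = (\<lambda>\<omega>. (Y \<omega> * of_bool (X \<omega> = n)) * z ^ n)"
        by (simp add: mult_ac)
      then show ?thesis by (simp only: integral_mult_left_zero)
    qed
    ultimately have "(\<lambda>n. expectation (\<lambda>\<omega>. Y \<omega> * of_bool (X \<omega> = n)) * z ^ n) sums
        expectation (\<lambda>\<omega>. Y \<omega> * z ^ X \<omega>)"
      by (simp only:)
    from sums_diff[OF pgf[OF z] this] show "(\<lambda>n. (a n - expectation (\<lambda>\<omega>. Y \<omega> * of_bool (X \<omega> = n))) * z ^ n) sums 0"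
      by (simp add: left_diff_distrib)
  qed
  then show ?thesis by simp
qed

text \<open>The variables are inverted one at a time: in the auxiliary claim the indices in
  \<open>A\<close> already carry the event \<open>X i \<omega> = n i\<close>, the remaining ones
  still carry the power \<open>z i ^ X i \<omega>\<close>.\<close>

lemma prob_if_poisson_pgf:
  assumes I: "finite I" and X [measurable]: "\<And>i. i \<in> I \<Longrightarrow> X i \<in> measurable M (count_space UNIV)"
    and pgf: "\<And>z. (\<And>i. i \<in> I \<Longrightarrow> 0 \<le> z i \<and> z i \<le> 1) \<Longrightarrow>
      expectation (\<lambda>\<omega>. \<Prod>i\<in>I. z i ^ X i \<omega>) = (\<Prod>i\<in>I. exp (- ((1 - z i) * m i)))"
  shows "prob {\<omega> \<in> space M. \<forall>i\<in>I. X i \<omega> = n i} = (\<Prod>i\<in>I. poisson_prob (m i) (n i))"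
proof -
  have *: "expectation (\<lambda>\<omega>. (\<Prod>i\<in>A. of_bool (X i \<omega> = n i)) * (\<Prod>i\<in>I - A. z i ^ X i \<omega>))
      = (\<Prod>i\<in>A. poisson_prob (m i) (n i)) * (\<Prod>i\<in>I - A. exp (- ((1 - z i) * m i)))"
    if "A \<subseteq> I" "\<And>i. i \<in> I \<Longrightarrow> 0 \<le> z i \<and> z i \<le> 1" for A z
    using finite_subset[OF that(1) I] that
  proof (induction A arbitrary: z)
    case empty
    then show ?case using pgf[of z] by simp
  next
    case (insert j A)
    define J where "J = I - insert j A"
    define Y where "Y \<omega> = (\<Prod>i\<in>A. of_bool (X i \<omega> = n i)) * (\<Prod>i\<in>J. z i ^ X i \<omega>)" for \<omega>
    define q where "q = (\<Prod>i\<in>A. poisson_prob (m i) (n i)) * (\<Prod>i\<in>J. exp (- ((1 - z i) * m i)))"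
    have split: "I - A = insert j J" "j \<notin> J" "finite J" and sub: "A \<subseteq> I" "j \<in> I" "J \<subseteq> I" "finite A"
      using insert I by (auto simp: J_def)
    have [measurable]: "X j \<in> measurable M (count_space UNIV)" using sub by simp
    have "expectation (\<lambda>\<omega>. Y \<omega> * of_bool (X j \<omega> = n j)) = q * poisson_prob (m j) (n j)"
    proof (rule expectation_of_bool_eq_if_pgf_eq[where C = 1])
      show "Y \<in> borel_measurable M"
        unfolding Y_def using sub by (intro borel_measurable_times borel_measurable_prod) (auto intro!: measurable_compose[OF X])
      show "\<bar>Y \<omega>\<bar> \<le> 1" for \<omega>
        unfolding Y_def abs_mult abs_prod using insert.prems(2) sub
        by (intro mult_le_one prod_le_1 prod_nonneg) (auto simp: power_le_one subset_iff)
      fix w :: real assume w: "0 < w" "w < 1"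
      have "expectation (\<lambda>\<omega>. Y \<omega> * w ^ X j \<omega>) = q * exp (- ((1 - w) * m j))"
      proof -
        have eq: "(\<Prod>i\<in>J. f ((z(j := w)) i) i) = (\<Prod>i\<in>J. f (z i) i)" for f :: "real \<Rightarrow> 'b \<Rightarrow> real"
          using split by (intro prod.cong) auto
        \<comment> \<open>The induction hypothesis, with \<open>z j\<close> replaced by the free
          variable \<open>w\<close>, supplies the power series in \<open>w\<close>.\<close>
        have "expectation (\<lambda>\<omega>. (\<Prod>i\<in>A. of_bool (X i \<omega> = n i)) * (\<Prod>i\<in>I - A. (z(j := w)) i ^ X i \<omega>))
            = (\<Prod>i\<in>A. poisson_prob (m i) (n i)) * (\<Prod>i\<in>I - A. exp (- ((1 - (z(j := w)) i) * m i)))"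
          using sub insert.prems w by (intro insert.IH) auto
        then show ?thesis
          using split eq[of "\<lambda>x i. exp (- ((1 - x) * m i))"] eq[of "\<lambda>x i. x ^ X i _"]
          by (simp add: Y_def q_def mult_ac)
      qed
      then show "(\<lambda>n. q * poisson_prob (m j) n * w ^ n) sums expectation (\<lambda>\<omega>. Y \<omega> * w ^ X j \<omega>)"
        using sums_mult[OF poisson_pgf_sums[of "m j" w], of q] by (simp add: mult.assoc)
    qed simp
    then show ?case
      using insert sub by (simp add: Y_def q_def J_def mult_ac)
  qed
  have "expectation (\<lambda>\<omega>. \<Prod>i\<in>I. of_bool (X i \<omega> = n i)) = (\<Prod>i\<in>I. poisson_prob (m i) (n i))"
    using *[of I "\<lambda>_. 0"] by simp
  moreover have "expectation (\<lambda>\<omega>. \<Prod>i\<in>I. of_bool (X i \<omega> = n i) :: real)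
      = expectation (indicator {\<omega> \<in> space M. \<forall>i\<in>I. X i \<omega> = n i})"
    by (intro Bochner_Integration.integral_cong) (auto simp: indicator_def intro!: prod_zero I)
  moreover have "{\<omega> \<in> space M. \<forall>i\<in>I. X i \<omega> = n i} \<inter> space M = {\<omega> \<in> space M. \<forall>i\<in>I. X i \<omega> = n i}"
    by auto
  ultimately show ?thesis by simp
qed

text \<open>The generating function determines the joint law of every subfamily as a product of
  Poisson laws, which is independence on a generator of the power set.\<close>

lemma indep_poisson_if_pgf:
  assumes I: "finite I" and X [measurable]: "\<And>i. i \<in> I \<Longrightarrow> X i \<in> measurable M (count_space UNIV)"
    and pgf: "\<And>z. (\<And>i. i \<in> I \<Longrightarrow> 0 \<le> z i \<and> z i \<le> 1) \<Longrightarrow>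
      expectation (\<lambda>\<omega>. \<Prod>i\<in>I. z i ^ X i \<omega>) = (\<Prod>i\<in>I. exp (- ((1 - z i) * m i)))"
  shows "indep_vars (\<lambda>_. count_space UNIV) X I"
    and "i \<in> I \<Longrightarrow> prob {\<omega> \<in> space M. X i \<omega> = k} = poisson_prob (m i) k"
proof -
  have joint: "prob {\<omega> \<in> space M. \<forall>i\<in>J. X i \<omega> = n i} = (\<Prod>i\<in>J. poisson_prob (m i) (n i))"
    if J: "J \<subseteq> I" for J n
  proof (rule prob_if_poisson_pgf)
    fix z :: "'b \<Rightarrow> real" assume z: "\<And>i. i \<in> J \<Longrightarrow> 0 \<le> z i \<and> z i \<le> 1"
    \<comment> \<open>Putting the other variables equal to 1 passes to the subfamily
      \<open>J\<close>.\<close>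
    define y where "y i = (if i \<in> J then z i else 1)" for i
    have "(\<Prod>i\<in>I. f (y i) i) = (\<Prod>i\<in>J. f (z i) i)" if "\<And>i. f 1 i = 1" for f :: "real \<Rightarrow> 'b \<Rightarrow> real"
      using I J that by (intro prod.mono_neutral_cong_right) (auto simp: y_def)
    from this[of "\<lambda>x i. exp (- ((1 - x) * m i))"] this[of "\<lambda>x i. x ^ X i _"]
    show "expectation (\<lambda>\<omega>. \<Prod>i\<in>J. z i ^ X i \<omega>) = (\<Prod>i\<in>J. exp (- ((1 - z i) * m i)))"
      using pgf[of y] z by (simp add: y_def[abs_def] split: if_splits)
  qed (use J I finite_subset in auto)
  show marg: "prob {\<omega> \<in> space M. X i \<omega> = k} = poisson_prob (m i) k" if "i \<in> I" for i k
    using joint[of "{i}" "\<lambda>_. k"] that by simp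
  show "indep_vars (\<lambda>_. count_space UNIV) X I"
  proof (cases "I = {}")
    case True
    then show ?thesis by (simp add: indep_vars_def indep_sets_def)
  next
    case False
    \<comment> \<open>The empty set makes the singletons stable under intersection;
      \<open>UNIV\<close> stands for a coordinate without condition.\<close>
    define E :: "nat set set" where "E = {{}, UNIV} \<union> range (\<lambda>k. {k})"
    have "indep_vars (\<lambda>_. count_space UNIV) X I \<longleftrightarrow> (\<forall>A\<in>(\<Pi> i\<in>I. E).
        prob (\<Inter>j\<in>I. X j -` A j \<inter> space M) = (\<Prod>j\<in>I. prob (X j -` A j \<inter> space M)))"
    proof (rule indep_vars_finite[OF False I])
      have "Pow UNIV \<subseteq> sigma_sets UNIV E"
        using sigma_sets_mono'[of "range (\<lambda>k::nat. {k})" E UNIV] sigma_sets_singletons[of "UNIV :: nat set"]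
        by (auto simp: E_def)
      then show "sets (count_space UNIV) = sigma_sets (space (count_space UNIV)) E"
        using sigma_sets_into_sp[of E UNIV] by auto
      show "Int_stable E" by (auto simp: Int_stable_def E_def)
    qed (auto simp: E_def)
    also have "\<dots>"
    proof
      fix A assume A: "A \<in> (\<Pi> i\<in>I. E)"
      show "prob (\<Inter>j\<in>I. X j -` A j \<inter> space M) = (\<Prod>j\<in>I. prob (X j -` A j \<inter> space M))"
      proof (cases "\<exists>j\<in>I. A j = {}")
        case True
        then have "(\<Inter>j\<in>I. X j -` A j \<inter> space M) = {}" by auto
        moreover have "(\<Prod>j\<in>I. prob (X j -` A j \<inter> space M)) = 0"
          using True I by (intro prod_zero) (auto intro: rev_bexI)
        ultimately show ?thesis by simp
      next
        case ne: False
        \<comment> \<open>The coordinates outside \<open>J\<close> contribute a factor 1; those in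
          \<open>J\<close> are restricted to singletons and fall under \<open>joint\<close>.\<close>
        define J where "J = {j \<in> I. A j \<noteq> UNIV}"
        have "\<forall>j\<in>J. \<exists>k. A j = {k}" using A ne by (auto simp: J_def E_def Pi_iff)
        then obtain n where n: "\<And>j. j \<in> J \<Longrightarrow> A j = {n j}" by metis
        have "(\<Inter>j\<in>I. X j -` A j \<inter> space M) = {\<omega> \<in> space M. \<forall>j\<in>J. X j \<omega> = n j}"
          proof -
          have "X j \<omega> \<in> A j \<longleftrightarrow> (j \<in> J \<longrightarrow> X j \<omega> = n j)" if "j \<in> I" for j \<omega>
            using n[of j] that by (cases "j \<in> J") (auto simp: J_def)
          moreover have "J \<subseteq> I" by (auto simp: J_def)
          ultimately show ?thesis using False by blast
        qed
        then have "prob (\<Inter>j\<in>I. X j -` A j \<inter> space M) = (\<Prod>j\<in>J. poisson_prob (m j) (n j))"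
          using joint[of J n] by (simp add: J_def)
        also have "\<dots> = (\<Prod>j\<in>J. prob (X j -` A j \<inter> space M))"
        proof (rule prod.cong[OF refl])
          fix j assume j: "j \<in> J"
          have "X j -` A j \<inter> space M = {\<omega> \<in> space M. X j \<omega> = n j}" using n[OF j] by auto
          then show "poisson_prob (m j) (n j) = prob (X j -` A j \<inter> space M)"
            using marg[of j "n j"] j by (simp add: J_def)
        qed
        also have "\<dots> = (\<Prod>j\<in>I. prob (X j -` A j \<inter> space M))"
          using I prob_space by (intro prod.mono_neutral_left) (auto simp: J_def)
        finally show ?thesis .
      qed
    qed
    finally show ?thesis .
  qed
qed

end

subsection \<open>The generating functional of a Poisson process\<close>

lemma poisson_processD:
  assumes "poisson_process M T r N"
  shows "t \<in> {0..T} \<Longrightarrow> N t \<in> measurable M (count_space UNIV)"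
    and "AE \<omega> in M. N 0 \<omega> = 0"
    and "0 \<le> s 0 \<Longrightarrow> (\<And>k. k < n \<Longrightarrow> s k \<le> s (Suc k)) \<Longrightarrow> s n \<le> T \<Longrightarrow>
      prob_space.indep_vars M (\<lambda>_. count_space UNIV) (\<lambda>k \<omega>. N (s (Suc k)) \<omega> - N (s k) \<omega>) {..<n}"
    and "0 \<le> u \<Longrightarrow> u \<le> v \<Longrightarrow> v \<le> T \<Longrightarrow> measure M {\<omega> \<in> space M. N v \<omega> - N u \<omega> = k} =
      poisson_prob (LINT s:{u<..v}|lborel. r s) k"
  using assms unfolding poisson_process_def poisson_prob_def by simp_all

text \<open>The index \<open>j\<close> of the cell \<open>(j * \<delta>, (j + 1) * \<delta>]\<close> containing \<open>x > 0\<close>.\<close>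

definition cell :: "real \<Rightarrow> real \<Rightarrow> nat" where
  "cell \<delta> x = nat (\<lceil>x / \<delta>\<rceil> - 1)"

text \<open>The cells are closed on the right because the increments count the points of
  \<open>(u, v]\<close>; hence the ceiling. The condition \<open>0 < x\<close> appears because
  \<open>nat\<close> sends every \<open>x \<le> 0\<close> to index 0.\<close>

lemma cell_iff:
  assumes "0 < \<delta>"
  shows "real j * \<delta> < x \<and> x \<le> real (Suc j) * \<delta> \<longleftrightarrow> 0 < x \<and> cell \<delta> x = j"
proof -
  have "cell \<delta> x = j \<longleftrightarrow> \<lceil>x / \<delta>\<rceil> = int (Suc j)" if "0 < x"
  proof -
    have "0 < \<lceil>x / \<delta>\<rceil>" using that assms by simp
    then show ?thesis by (auto simp: cell_def)
  qed
  moreover have "\<lceil>x / \<delta>\<rceil> = int (Suc j) \<longleftrightarrow> real j * \<delta> < x \<and> x \<le> real (Suc j) * \<delta>"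
    using assms by (simp add: ceiling_eq_iff pos_less_divide_eq pos_divide_le_eq)
  moreover have "0 < x" if "real j * \<delta> < x"
    using that assms by (meson mult_nonneg_nonneg of_nat_0_le_iff less_imp_le le_less_trans)
  ultimately show ?thesis by blast
qed

lemma cell_measurable [measurable]: "cell \<delta> \<in> measurable borel (count_space UNIV)"
  unfolding cell_def[abs_def] by measurable

text \<open>The left end point of the cell is strictly below \<open>x\<close>, even if
  \<open>x\<close> is a grid point, and at most one mesh width away. This is convergence along
  \<open>at_left x\<close>, where only left continuity of a function is needed.\<close>

lemma left_grid_point_tendsto:
  assumes "0 < x" "0 < T"
  shows "filterlim (\<lambda>n. real (cell (T / real (Suc n)) x) * (T / real (Suc n))) (at_left x) sequentially"
proof -
  let ?e = "\<lambda>n. real (cell (T / real (Suc n)) x) * (T / real (Suc n))"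
  have e: "?e n < x" "x - T / real (Suc n) \<le> ?e n" for n
    using cell_iff[of "T / real (Suc n)" "cell (T / real (Suc n)) x" x] assms
    by (auto simp: algebra_simps)
  have "?e \<longlonglongrightarrow> x"
  proof (rule tendsto_sandwich)
    have "(\<lambda>n. T / real (Suc n)) \<longlonglongrightarrow> 0"
      by (rule LIMSEQ_Suc[OF lim_const_over_n])
    from tendsto_diff[OF tendsto_const this]
    show "(\<lambda>n. x - T / real (Suc n)) \<longlonglongrightarrow> x" by simp
    show "\<forall>\<^sub>F n in sequentially. x - T / real (Suc n) \<le> ?e n" by (intro always_eventually allI e(2))
    show "\<forall>\<^sub>F n in sequentially. ?e n \<le> x" by (intro always_eventually allI less_imp_le e(1))
  qed simp
  then show ?thesis
    by (rule tendsto_imp_filterlim_at_left, intro always_eventually allI e(1))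
qed

context prob_space
begin

lemma expectation_power_poisson:
  assumes [measurable]: "X \<in> measurable M (count_space UNIV)"
    and law: "\<And>n. prob {\<omega> \<in> space M. X \<omega> = n} = poisson_prob m n"
    and c: "0 \<le> c" "c \<le> 1"
  shows "expectation (\<lambda>\<omega>. c ^ X \<omega>) = exp (- ((1 - c) * m))"
proof -
  have "(\<lambda>n. expectation (\<lambda>\<omega>. c ^ n * of_bool (X \<omega> = n))) sums expectation (\<lambda>\<omega>. c ^ X \<omega>)"
    using c by (intro expectation_sums_nat[where C = 1]) (auto simp: power_le_one)
  moreover have "expectation (\<lambda>\<omega>. c ^ n * of_bool (X \<omega> = n)) = poisson_prob m n * c ^ n" for n
  proof -
    have "expectation (\<lambda>\<omega>. of_bool (X \<omega> = n) :: real) = expectation (indicator {\<omega> \<in> space M. X \<omega> = n})"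
      by (intro Bochner_Integration.integral_cong) (auto simp: indicator_def)
    also have "\<dots> = poisson_prob m n" using law[of n] by simp
    finally show ?thesis by simp
  qed
  ultimately have "(\<lambda>n. poisson_prob m n * c ^ n) sums expectation (\<lambda>\<omega>. c ^ X \<omega>)" by (simp only:)
  then show ?thesis using poisson_pgf_sums sums_unique2 by blast
qed

text \<open>
  The functional is first computed for the step function that is constant on the cells of a grid
  and takes the value of \<open>g\<close> at the left end point; left continuity of \<open>g\<close> lets the mesh
  tend to 0.
\<close>

lemma poisson_process_laplace_functional:
  fixes K :: "'a \<Rightarrow> nat" and A :: "nat \<Rightarrow> 'a \<Rightarrow> real"
  assumes T: "0 < T" and K [measurable]: "K \<in> measurable M (count_space UNIV)"
    and A [measurable]: "\<And>i. A i \<in> borel_measurable M"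
    and range: "\<And>\<omega> i. \<omega> \<in> space M \<Longrightarrow> i < K \<omega> \<Longrightarrow> A i \<omega> \<in> {0..T}"
    and pp: "poisson_process M T (\<lambda>_. r) (\<lambda>t \<omega>. card {i. i < K \<omega> \<and> A i \<omega> \<le> t})"
    and g [measurable]: "g \<in> borel_measurable borel" and g01: "\<And>x. 0 \<le> g x \<and> g x \<le> 1"
    and left: "\<And>x. 0 < x \<Longrightarrow> x \<le> T \<Longrightarrow> (g \<longlongrightarrow> g x) (at_left x)"
  shows "expectation (\<lambda>\<omega>. \<Prod>i<K \<omega>. g (A i \<omega>)) = exp (- (r * (LINT x:{0<..T}|lborel. 1 - g x)))"
proof -
  define N where "N t \<omega> = card {i. i < K \<omega> \<and> A i \<omega> \<le> t}" for t \<omega>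
  have fin: "finite {i. i < K \<omega> \<and> P i}" for \<omega> P
    by (rule finite_subset[of _ "{..<K \<omega>}"]) auto
  note N = poisson_processD[OF pp, folded N_def]
  have N_meas: "N t \<in> measurable M (count_space UNIV)" if "t \<in> {0..T}" for t
    using that by (rule N(1))
  have N_0: "AE \<omega> in M. N 0 \<omega> = 0"
    by (rule N(2))
  have N_indep: "indep_vars (\<lambda>_. count_space UNIV) (\<lambda>k \<omega>. N (t (Suc k)) \<omega> - N (t k) \<omega>) {..<n}"
    if "0 \<le> t 0" "\<And>k. k < n \<Longrightarrow> t k \<le> t (Suc k)" "t n \<le> T" for t :: "nat \<Rightarrow> real" and n
    using that by (rule N(3))
  have N_law: "prob {\<omega> \<in> space M. N v \<omega> - N u \<omega> = n} = poisson_prob (r * (v - u)) n"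
    if "0 \<le> u" "u \<le> v" "v \<le> T" for u v n
  proof -
    have "(LINT s:{u<..v}|lborel. r) = r * (v - u)"
      using that by (simp add: set_lebesgue_integral_def)
    then show ?thesis using N(4)[OF that] by simp
  qed
  \<comment> \<open>An arrival at 0 would lie in none of the cells; it is excluded by
    \<open>N 0 \<omega> = 0\<close>, which holds almost surely.\<close>
  have pos: "\<forall>i<K \<omega>. 0 < A i \<omega>" if "N 0 \<omega> = 0" for \<omega>
  proof -
    have "{i. i < K \<omega> \<and> A i \<omega> \<le> 0} = {}"
      using that fin[of \<omega> "\<lambda>i. A i \<omega> \<le> 0"] by (simp only: N_def card_0_eq)
    then show ?thesis by force
  qed
  have AE_pos: "AE \<omega> in M. \<forall>i<K \<omega>. 0 < A i \<omega>"
    using N_0 pos by (auto elim!: eventually_mono)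
  define \<delta> where "\<delta> n = T / real (Suc n)" for n
  have \<delta>: "0 < \<delta> n" "real (Suc n) * \<delta> n = T" for n using T by (auto simp: \<delta>_def)
  have grid: "0 \<le> real j * \<delta> n" "real j * \<delta> n \<le> T" if "j \<le> Suc n" for j n
    using that \<delta>[of n] mult_right_mono[of "real j" "real (Suc n)" "\<delta> n"] by auto
  have cell_less: "cell (\<delta> n) x < Suc n" if "0 < x" "x \<le> T" for x n
  proof (rule ccontr)
    assume "\<not> cell (\<delta> n) x < Suc n"
    then have "T \<le> real (cell (\<delta> n) x) * \<delta> n"
      using \<delta>[of n] mult_right_mono[of "real (Suc n)" "real (cell (\<delta> n) x)" "\<delta> n"] by auto
    then show False using cell_iff[OF \<delta>(1)[of n], of "cell (\<delta> n) x" x] that by auto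
  qed
  define e where "e n x = real (cell (\<delta> n) x) * \<delta> n" for n x
  have [measurable]: "e n \<in> borel_measurable borel" for n unfolding e_def[abs_def] by measurable
  have g_e: "(\<lambda>n. g (e n x)) \<longlonglongrightarrow> g x" if "0 < x" "x \<le> T" for x
    unfolding e_def \<delta>_def
    by (rule filterlim_compose[OF left left_grid_point_tendsto]) (use that T in auto)
  have step: "expectation (\<lambda>\<omega>. \<Prod>i<K \<omega>. g (e n (A i \<omega>))) = exp (- (r * (LINT x:{0<..T}|lborel. 1 - g (e n x))))"
    for n
  proof -
    define X where "X j \<omega> = N (real (Suc j) * \<delta> n) \<omega> - N (real j * \<delta> n) \<omega>" for j \<omega>
    have X_meas [measurable]: "X j \<in> measurable M (count_space UNIV)" if "j < Suc n" for j
    proof -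
      have [measurable]: "N (real j * \<delta> n) \<in> measurable M (count_space UNIV)"
        "N (real (Suc j) * \<delta> n) \<in> measurable M (count_space UNIV)"
        using grid[of j n] grid[of "Suc j" n] that by (auto intro!: N_meas simp del: of_nat_Suc)
      show ?thesis unfolding X_def[abs_def] by measurable
    qed
    have X_indep: "indep_vars (\<lambda>_. count_space UNIV) X {..<Suc n}"
      unfolding X_def[abs_def]
      by (rule N_indep) (use \<delta> in \<open>auto simp: mult_right_mono less_imp_le\<close>)
    have X_law: "prob {\<omega> \<in> space M. X j \<omega> = k} = poisson_prob (r * \<delta> n) k" if "j < Suc n" for j k
      unfolding X_def using that grid[of j n] grid[of "Suc j" n] \<delta>(1)[of n]
      by (subst N_law) (auto simp: algebra_simps)
    \<comment> \<open>Arrivals are grouped by cells: the step function is constant on cell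
      \<open>j\<close>, which contains \<open>X j \<omega>\<close> of them.\<close>
    have prod_eq: "(\<Prod>i<K \<omega>. g (e n (A i \<omega>))) = (\<Prod>j<Suc n. g (real j * \<delta> n) ^ X j \<omega>)"
      if \<omega>: "\<omega> \<in> space M" "N 0 \<omega> = 0" for \<omega>
    proof -
      have A_range: "0 < A i \<omega>" "A i \<omega> \<le> T" if "i < K \<omega>" for i
        using pos[OF \<omega>(2)] range[OF \<omega>(1)] that by auto
      have card: "card {i \<in> {..<K \<omega>}. cell (\<delta> n) (A i \<omega>) = j} = X j \<omega>" for j
      proof -
        have iff: "cell (\<delta> n) (A i \<omega>) = j \<longleftrightarrow> real j * \<delta> n < A i \<omega> \<and> A i \<omega> \<le> real (Suc j) * \<delta> n"
          if "i < K \<omega>" for i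
          using cell_iff[OF \<delta>(1)[of n], of j "A i \<omega>"] A_range(1)[OF that] by blast
        have "{i \<in> {..<K \<omega>}. cell (\<delta> n) (A i \<omega>) = j}
            = {i. i < K \<omega> \<and> A i \<omega> \<le> real (Suc j) * \<delta> n} - {i. i < K \<omega> \<and> A i \<omega> \<le> real j * \<delta> n}"
          by (rule set_eqI, use iff in \<open>simp only: mem_Collect_eq Diff_iff lessThan_iff not_le[symmetric]\<close>) blast
        moreover have "{i. i < K \<omega> \<and> A i \<omega> \<le> real j * \<delta> n} \<subseteq> {i. i < K \<omega> \<and> A i \<omega> \<le> real (Suc j) * \<delta> n}"
          using \<delta>(1)[of n] by (auto simp: algebra_simps)
        ultimately show ?thesis unfolding X_def N_def by (simp add: card_Diff_subset fin)
      qed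
      have "(\<Prod>i<K \<omega>. g (e n (A i \<omega>)))
          = (\<Prod>j<Suc n. \<Prod>i\<in>{i \<in> {..<K \<omega>}. cell (\<delta> n) (A i \<omega>) = j}. g (e n (A i \<omega>)))"
        by (rule prod.group[symmetric]) (use cell_less A_range in auto)
      also have "\<dots> = (\<Prod>j<Suc n. g (real j * \<delta> n) ^ X j \<omega>)"
        unfolding card[symmetric] by (intro prod.cong refl) (simp add: e_def)
      finally show ?thesis .
    qed
    have "expectation (\<lambda>\<omega>. \<Prod>i<K \<omega>. g (e n (A i \<omega>))) = expectation (\<lambda>\<omega>. \<Prod>j<Suc n. g (real j * \<delta> n) ^ X j \<omega>)"
    proof (rule integral_cong_AE)
      show "(\<lambda>\<omega>. \<Prod>i<K \<omega>. g (e n (A i \<omega>))) \<in> borel_measurable M"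
        by (rule measurable_compose_countable[OF _ K]) measurable
      show "(\<lambda>\<omega>. \<Prod>j<Suc n. g (real j * \<delta> n) ^ X j \<omega>) \<in> borel_measurable M"
        by (intro borel_measurable_prod measurable_compose[OF X_meas]) auto
      show "AE \<omega> in M. (\<Prod>i<K \<omega>. g (e n (A i \<omega>))) = (\<Prod>j<Suc n. g (real j * \<delta> n) ^ X j \<omega>)"
        using N_0 AE_space by eventually_elim (rule prod_eq)
    qed
    also have "\<dots> = (\<Prod>j<Suc n. expectation (\<lambda>\<omega>. g (real j * \<delta> n) ^ X j \<omega>))"
    proof (rule indep_vars_lebesgue_integral)
      show "indep_vars (\<lambda>_. borel) (\<lambda>j \<omega>. g (real j * \<delta> n) ^ X j \<omega>) {..<Suc n}"
        by (rule indep_vars_compose2[OF X_indep]) simp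
      show "integrable M (\<lambda>\<omega>. g (real j * \<delta> n) ^ X j \<omega>)" if "j \<in> {..<Suc n}" for j
      proof (rule integrable_const_bound[of _ 1])
        show "(\<lambda>\<omega>. g (real j * \<delta> n) ^ X j \<omega>) \<in> borel_measurable M"
          by (rule measurable_compose[OF X_meas]) (use that in auto)
      qed (use g01 in \<open>auto simp: power_le_one intro!: AE_I2\<close>)
    qed simp
    also have "\<dots> = (\<Prod>j<Suc n. exp (- ((1 - g (real j * \<delta> n)) * (r * \<delta> n))))"
      using g01 X_law by (intro prod.cong refl expectation_power_poisson) auto
    also have "\<dots> = exp (- (r * (\<Sum>j<Suc n. (1 - g (real j * \<delta> n)) * \<delta> n)))"
      by (simp add: exp_sum[symmetric] sum_distrib_left sum_negf mult_ac del: sum.lessThan_Suc prod.lessThan_Suc)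
    also have "(\<Sum>j<Suc n. (1 - g (real j * \<delta> n)) * \<delta> n) = (LINT x:{0<..T}|lborel. 1 - g (e n x))"
    proof -
      \<comment> \<open>The cells partition \<open>(0, T]\<close>, so the Riemann sum equals the
        integral of the step function without an error term.\<close>
      have eq: "indicator {0<..T} x * (1 - g (e n x))
          = (\<Sum>j<Suc n. (1 - g (real j * \<delta> n)) * indicator {real j * \<delta> n<..real (Suc j) * \<delta> n} x)" for x
      proof -
        have ind: "indicator {real j * \<delta> n<..real (Suc j) * \<delta> n} x = (of_bool (0 < x \<and> cell (\<delta> n) x = j) :: real)" for j
          using cell_iff[OF \<delta>(1)[of n], of j x] by (simp add: indicator_def)
        show ?thesis
        proof (cases "0 < x \<and> x \<le> T")
          case True
          then show ?thesis
            using cell_less[of x n] unfolding ind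
            by (subst sum.remove[of _ "cell (\<delta> n) x"]) (auto simp: e_def intro!: sum.neutral)
        next
          case False
          have "\<not> (0 < x \<and> cell (\<delta> n) x = j)" if "j < Suc n" for j
            using cell_iff[OF \<delta>(1)[of n], of j x] grid[of "Suc j" n] that False by auto
          then have "(\<Sum>j<Suc n. (1 - g (real j * \<delta> n)) * of_bool (0 < x \<and> cell (\<delta> n) x = j)) = 0"
            by (intro sum.neutral) auto
          then show ?thesis
            using False unfolding ind by simp
        qed
      qed
      have int: "integrable lborel (\<lambda>x. (1 - g (real j * \<delta> n)) * indicator {real j * \<delta> n<..real (Suc j) * \<delta> n} x)" for j
        using \<delta>(1)[of n] by (intro integrable_mult_right integrable_real_indicator) (auto simp: mult_right_mono)
      show ?thesis
        unfolding set_lebesgue_integral_def real_scaleR_def eq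
        using \<delta>(1)[of n] by (subst Bochner_Integration.integral_sum[OF int]) (simp add: algebra_simps)
    qed
    finally show ?thesis .
  qed
  have "(\<lambda>n. expectation (\<lambda>\<omega>. \<Prod>i<K \<omega>. g (e n (A i \<omega>)))) \<longlonglongrightarrow> expectation (\<lambda>\<omega>. \<Prod>i<K \<omega>. g (A i \<omega>))"
  proof (rule integral_dominated_convergence[where w = "\<lambda>_. 1"])
    show "(\<lambda>\<omega>. \<Prod>i<K \<omega>. g (A i \<omega>)) \<in> borel_measurable M"
      by (rule measurable_compose_countable[OF _ K]) measurable
    show "(\<lambda>\<omega>. \<Prod>i<K \<omega>. g (e n (A i \<omega>))) \<in> borel_measurable M" for n
      by (rule measurable_compose_countable[OF _ K]) measurable
    show "AE \<omega> in M. (\<lambda>n. \<Prod>i<K \<omega>. g (e n (A i \<omega>))) \<longlonglongrightarrow> (\<Prod>i<K \<omega>. g (A i \<omega>))"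
      using AE_pos AE_space by eventually_elim (use range in \<open>auto intro!: tendsto_prod g_e\<close>)
    show "AE \<omega> in M. norm (\<Prod>i<K \<omega>. g (e n (A i \<omega>))) \<le> 1" for n
      using g01 by (auto intro!: AE_I2 prod_le_1 simp: abs_prod)
  qed simp
  moreover have "(\<lambda>n. LINT x:{0<..T}|lborel. 1 - g (e n x)) \<longlonglongrightarrow> (LINT x:{0<..T}|lborel. 1 - g x)"
    unfolding set_lebesgue_integral_def
  proof (rule integral_dominated_convergence[where w = "indicator {0<..T}"])
    show "integrable lborel (indicator {0<..T} :: real \<Rightarrow> real)"
      using T by (intro integrable_real_indicator) auto
    show "AE x in lborel. (\<lambda>n. indicator {0<..T} x *\<^sub>R (1 - g (e n x))) \<longlonglongrightarrow> indicator {0<..T} x *\<^sub>R (1 - g x)"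
      using g_e by (auto intro!: AE_I2 tendsto_intros simp: indicator_def)
    show "AE x in lborel. norm (indicator {0<..T} x *\<^sub>R (1 - g (e n x))) \<le> indicator {0<..T} x" for n
      using g01 by (auto intro!: AE_I2 simp: indicator_def)
  qed measurable
  then have "(\<lambda>n. exp (- (r * (LINT x:{0<..T}|lborel. 1 - g (e n x))))) \<longlonglongrightarrow>
      exp (- (r * (LINT x:{0<..T}|lborel. 1 - g x)))"
    by (intro tendsto_intros)
  ultimately show ?thesis
    unfolding step by (rule LIMSEQ_unique)
qed

end

subsection \<open>The process of bids\<close>

context bidding
begin

text \<open>The mixture over departure: with weight
  \<open>1 - \<alpha>\<^sub>2 / \<alpha>\<^sub>3\<close> only a bid by \<open>min t (T - d)\<close>
  counts, with weight \<open>\<alpha>\<^sub>2 / \<alpha>\<^sub>3\<close> any bid by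
  \<open>t\<close>. Monotonicity and bounds are inherited from \<open>surv_at\<close> in this
  form.\<close>

lemma placed_at_eq:
  "placed_at t x = 1 - (1 - \<alpha>\<^sub>2 / \<alpha>\<^sub>3) * surv_at (min t (T - d)) x - (\<alpha>\<^sub>2 / \<alpha>\<^sub>3) * surv_at t x"
  by (simp add: placed_at_def algebra_simps)

lemma placed_at_mono:
  assumes "s \<le> t" "t \<le> T"
  shows "placed_at s x \<le> placed_at t x"
proof -
  have "(\<alpha>\<^sub>2 / \<alpha>\<^sub>3) * surv_at t x \<le> (\<alpha>\<^sub>2 / \<alpha>\<^sub>3) * surv_at s x"
    using assms ratio_bounds by (intro mult_left_mono surv_at_mono)
  moreover have "(1 - \<alpha>\<^sub>2 / \<alpha>\<^sub>3) * surv_at (min t (T - d)) x \<le> (1 - \<alpha>\<^sub>2 / \<alpha>\<^sub>3) * surv_at (min s (T - d)) x"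
    using assms ratio_bounds by (intro mult_left_mono surv_at_mono) auto
  ultimately show ?thesis unfolding placed_at_eq by linarith
qed

lemma placed_at_bounds:
  assumes "t \<le> T"
  shows "0 \<le> placed_at t x" "placed_at t x \<le> 1"
proof -
  have m: "min t (T - d) \<le> T" using assms by simp
  note b = surv_at_bounds[OF assms, of x] surv_at_bounds[OF m, of x] ratio_bounds
  have "(1 - \<alpha>\<^sub>2 / \<alpha>\<^sub>3) * surv_at (min t (T - d)) x + (\<alpha>\<^sub>2 / \<alpha>\<^sub>3) * surv_at t x \<le> 1"
    using b by (intro convex_bound_le) auto
  then show "0 \<le> placed_at t x" unfolding placed_at_eq by linarith
  have "0 \<le> (1 - \<alpha>\<^sub>2 / \<alpha>\<^sub>3) * surv_at (min t (T - d)) x" "0 \<le> (\<alpha>\<^sub>2 / \<alpha>\<^sub>3) * surv_at t x"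
    using b by (intro mult_nonneg_nonneg; linarith)+
  then show "placed_at t x \<le> 1" unfolding placed_at_eq by linarith
qed

section \<open>Closed form of the bid time distribution\<close>

lemma placed_0 [simp]: "placed 0 = 0"
  using d_less by (simp add: placed_def)

lemma surv_late: "T - d \<le> t \<Longrightarrow> surv t = (d / T) powr \<alpha>\<^sub>2 * ((T - t) / d) powr \<alpha>\<^sub>3"
  using d_pos by (auto simp: surv_def)

lemma placed_T: "placed T = 1 - (d / T) powr \<alpha>\<^sub>2 * (1 - \<alpha>\<^sub>2 / \<alpha>\<^sub>3)"
  using d_pos by (simp add: placed_def surv_late min_def algebra_simps)

lemma placed_T_pos: "0 < placed T"
proof -
  have "0 < (d / T) powr \<alpha>\<^sub>2" "(d / T) powr \<alpha>\<^sub>2 \<le> 1" "0 < \<alpha>\<^sub>2 / \<alpha>\<^sub>3"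
    using T_pos d_pos d_less \<alpha>\<^sub>2_pos \<alpha>\<^sub>2_le by (auto intro!: powr_le1)
  then have "(d / T) powr \<alpha>\<^sub>2 * (1 - \<alpha>\<^sub>2 / \<alpha>\<^sub>3) < (d / T) powr \<alpha>\<^sub>2 * 1"
    by (intro mult_strict_left_mono) auto
  with \<open>(d / T) powr \<alpha>\<^sub>2 \<le> 1\<close> show ?thesis unfolding placed_T by linarith
qed

lemma placed_early: "t \<le> T - d \<Longrightarrow> placed t = 1 - (1 - t / T) powr \<alpha>\<^sub>2"
  using T_pos by (simp add: placed_def surv_def diff_divide_distrib)

lemma placed_late:
  assumes "T - d \<le> t" "t \<le> T"
  shows "placed t = placed T - (\<alpha>\<^sub>2 / \<alpha>\<^sub>3) * (d / T) powr \<alpha>\<^sub>2 * ((T - t) / d) powr \<alpha>\<^sub>3"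
proof -
  have "min t (T - d) = T - d" "min T (T - d) = T - d" using assms d_pos by auto
  then show ?thesis using assms d_pos by (simp add: placed_def surv_late algebra_simps)
qed

text \<open>Without outside information the test factor is 1, and \<open>placed_at t\<close> is
  averaged over the uniform arrival. For the second claim, bids after \<open>T\<close> are excluded
  almost surely by \<open>surv T = 0\<close>, which reduces it to the first at
  \<open>t = T\<close>.\<close>

lemma random_bidder_law:
  assumes rb: "random_bidder T d \<alpha>\<^sub>2 \<alpha>\<^sub>3 M S B D"
  shows "t \<in> {0..T} \<Longrightarrow>
      measure M {\<omega> \<in> space M. places_bid T d S B D \<omega> \<and> bid_time S B \<omega> \<le> t} = placed t"
    and "measure M {\<omega> \<in> space M. places_bid T d S B D \<omega>} = placed T"
proof -
  have distr: "distr M lborel (S 0) = uniform_measure lborel {0..T}"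
    and rule: "follows_bid_rule T d \<alpha>\<^sub>2 \<alpha>\<^sub>3 M (space M) {} {} S B D"
    using rb by (auto simp: random_bidder_def)
  interpret prob_space M using rb by (simp add: random_bidder_def)
  interpret bidder T d \<alpha>\<^sub>2 \<alpha>\<^sub>3 M "space M" "{}" "{}" S B D
    using rule sets.top[of "generated_by M {} {}"] by unfold_locales auto
  have uniform: "expectation (\<lambda>\<omega>. f (S 0 \<omega>)) = c"
    if [measurable]: "f \<in> borel_measurable borel" and f: "\<And>x. 0 \<le> f x" and int: "(f has_integral T * c) {0..T}"
    for f :: "real \<Rightarrow> real" and c
  proof -
    have "0 \<le> T * c" by (rule has_integral_nonneg[OF int]) (use f in auto)
    then have c: "0 \<le> c" using T_pos by (simp add: zero_le_mult_iff)
    have "(\<integral>\<^sup>+\<omega>. ennreal (f (S 0 \<omega>)) \<partial>M) = (\<integral>\<^sup>+x. ennreal (f x) \<partial>distr M lborel (S 0))"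
      by (subst nn_integral_distr) auto
    also have "\<dots> = (\<integral>\<^sup>+x. ennreal (f x) * indicator {0..T} x \<partial>lborel) / emeasure lborel {0..T}"
      unfolding distr by (rule nn_integral_uniform_measure) auto
    also have "(\<integral>\<^sup>+x. ennreal (f x) * indicator {0..T} x \<partial>lborel) = ennreal (T * c)"
      by (rule nn_integral_has_integral_lebesgue'[OF f int])
    also have "ennreal (T * c) / emeasure lborel {0..T} = ennreal c"
      using T_pos c by (simp add: divide_ennreal)
    finally show ?thesis
      using f c by (intro integral_eq_nn_integral[THEN trans]) auto
  qed
  have prob: "prob {\<omega> \<in> space M. places_bid T d S B D \<omega> \<and> bid_time S B \<omega> \<le> t} = placed t"
    if t: "t \<in> {0..T}" for t
  proof -
    have "expectation (\<lambda>\<omega>. 1 * of_bool (places_bid T d S B D \<omega> \<and> bid_time S B \<omega> \<le> t))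
        = expectation (\<lambda>\<omega>. 1 * placed_at t (S 0 \<omega>))"
      by (rule expectation_placed[of _ 1]) (use t in auto)
    also have "\<dots> = placed t"
      using t placed_at_bounds by (simp add: uniform placed_at_has_integral)
    also have "expectation (\<lambda>\<omega>. 1 * of_bool (places_bid T d S B D \<omega> \<and> bid_time S B \<omega> \<le> t) :: real)
        = expectation (indicator {\<omega> \<in> space M. places_bid T d S B D \<omega> \<and> bid_time S B \<omega> \<le> t})"
      by (intro Bochner_Integration.integral_cong) (auto simp: indicator_def)
    also have "\<dots> = prob {\<omega> \<in> space M. places_bid T d S B D \<omega> \<and> bid_time S B \<omega> \<le> t}"
      using places_bid_sets(1)[of S M B D T d t] by simp
    finally show ?thesis by simp
  qed
  then show "t \<in> {0..T} \<Longrightarrow>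
      prob {\<omega> \<in> space M. places_bid T d S B D \<omega> \<and> bid_time S B \<omega> \<le> t} = placed t" .
  have "expectation (\<lambda>\<omega>. 1 * of_bool (T < bid_time S B \<omega>)) = expectation (\<lambda>\<omega>. 1 * surv_at T (S 0 \<omega>))"
    by (rule expectation_later[of _ 1]) auto
  also have "\<dots> = 0"
    using surv_at_has_integral[of 0 T] T_pos surv_at_bounds[of T] by (simp add: uniform surv_after_def)
  also have "expectation (\<lambda>\<omega>. 1 * of_bool (T < bid_time S B \<omega>) :: real) = expectation (indicator {\<omega> \<in> space M. T < bid_time S B \<omega>})"
    by (intro Bochner_Integration.integral_cong) (auto simp: indicator_def)
  also have "\<dots> = prob {\<omega> \<in> space M. T < bid_time S B \<omega>}" by simp
  finally have "AE \<omega> in M. \<not> T < bid_time S B \<omega>"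
    by (subst (asm) prob_eq_0) (auto elim!: eventually_mono simp: eventually_conj_iff)
  then have "prob {\<omega> \<in> space M. places_bid T d S B D \<omega>}
      = prob {\<omega> \<in> space M. places_bid T d S B D \<omega> \<and> bid_time S B \<omega> \<le> T}"
    by (intro finite_measure_eq_AE places_bid_sets) (auto elim!: eventually_mono)
  then show "prob {\<omega> \<in> space M. places_bid T d S B D \<omega>} = placed T"
    using prob[of T] T_pos by simp
qed

end

locale auction_process = bidding + prob_space M
  for M :: "'a measure" +
  fixes rate :: real and K :: "'a \<Rightarrow> nat" and S :: "nat \<Rightarrow> nat \<Rightarrow> 'a \<Rightarrow> real"
    and B :: "nat \<Rightarrow> nat \<Rightarrow> 'a set" and D :: "nat \<Rightarrow> 'a set"
  assumes rate_pos: "0 < rate" and auction: "auction T rate d \<alpha>\<^sub>2 \<alpha>\<^sub>3 M K S B D"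
begin

text \<open>The arrival time of bidder \<open>i\<close> himself is among his outside variables, so
  that the arrivals can be conditioned on as a whole.\<close>

abbreviation "outer_vars i \<equiv> range (\<lambda>j. S j 0) \<union> {S j k | j k. j \<noteq> i}"

abbreviation "outer_events i \<equiv>
  range (\<lambda>n. {\<omega> \<in> space M. K \<omega> = n}) \<union> {B j k | j k. j \<noteq> i} \<union> {D j | j. j \<noteq> i}"

lemma rule: "follows_bid_rule T d \<alpha>\<^sub>2 \<alpha>\<^sub>3 M {\<omega> \<in> space M. i < K \<omega>} (outer_vars i) (outer_events i) (S i) (B i) (D i)"
  using auction unfolding auction_def by blast

lemma measurability [measurable]: "S i k \<in> borel_measurable M" "B i k \<in> sets M" "D i \<in> sets M"
  using rule[of i] unfolding follows_bid_rule_def by blast+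

lemma K_measurable [measurable]: "K \<in> measurable M (count_space UNIV)"
  using auction unfolding auction_def by blast

lemma outer_vars: "outer_vars i \<subseteq> borel_measurable M"
  using measurability(1) by blast

lemma K_sets: "{\<omega> \<in> space M. K \<omega> = n} \<in> sets M"
  by measurable

lemma outer_events: "outer_events i \<subseteq> sets M"
  using measurability(2,3) K_sets by blast

lemma outer_events_Pow: "outer_events i \<subseteq> Pow (space M)"
  using outer_events[of i] sets.space_closed[of M] by (rule subset_trans)

lemma other_bidder:
  assumes "i \<noteq> m"
  shows "S i k \<in> outer_vars m" "B i k \<in> outer_events m" "D i \<in> outer_events m"
  using assms by blast+

lemma exists_sets: "{\<omega> \<in> space M. i < K \<omega>} \<in> sets (generated_by M (outer_vars i) (outer_events i))"
proof -
  have K: "{\<omega> \<in> space M. K \<omega> = n} \<in> sets (generated_by M (outer_vars i) (outer_events i))" for n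
    by (rule generated_by_sets[OF outer_events_Pow]) auto
  have "(\<Union>n\<in>{i<..}. {\<omega> \<in> space M. K \<omega> = n}) \<in> sets (generated_by M (outer_vars i) (outer_events i))"
    by (intro sets.countable_UN') (use K in auto)
  also have "(\<Union>n\<in>{i<..}. {\<omega> \<in> space M. K \<omega> = n}) = {\<omega> \<in> space M. i < K \<omega>}" by auto
  finally show ?thesis .
qed

lemma bidder: "bidder T d \<alpha>\<^sub>2 \<alpha>\<^sub>3 M {\<omega> \<in> space M. i < K \<omega>} (outer_vars i) (outer_events i) (S i) (B i) (D i)"
  using outer_vars outer_events exists_sets rule by unfold_locales

section \<open>Replacing bidders by their conditional means\<close>

definition bid_by :: "nat \<Rightarrow> real \<Rightarrow> 'a \<Rightarrow> bool" where
  "bid_by i t \<omega> \<longleftrightarrow> places_bid T d (S i) (B i) (D i) \<omega> \<and> bid_time (S i) (B i) \<omega> \<le> t"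

text \<open>The weight is affine in the indicators of bids, so that
  \<open>expectation_placed\<close> applies term by term. The coefficients may have either sign;
  suitable \<open>w\<close> and \<open>c\<close> give the contribution of one bidder to the joint
  generating function of the increments.\<close>

definition weight :: "'k set \<Rightarrow> ('k \<Rightarrow> real) \<Rightarrow> ('k \<Rightarrow> real) \<Rightarrow> nat \<Rightarrow> 'a \<Rightarrow> real" where
  "weight I w c i \<omega> = 1 - (\<Sum>k\<in>I. w k * of_bool (bid_by i (c k) \<omega>))"

definition mean_weight :: "'k set \<Rightarrow> ('k \<Rightarrow> real) \<Rightarrow> ('k \<Rightarrow> real) \<Rightarrow> real \<Rightarrow> real" where
  "mean_weight I w c x = 1 - (\<Sum>k\<in>I. w k * placed_at (c k) x)"

lemma weight_measurable:
  assumes "\<And>k. S i k \<in> borel_measurable N" "\<And>k. B i k \<in> sets N" "D i \<in> sets N"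
  shows "weight I w c i \<in> borel_measurable N"
proof -
  have [measurable]: "{\<omega> \<in> space N. bid_by i t \<omega>} \<in> sets N" for t
    unfolding bid_by_def using assms by (rule places_bid_sets)
  show ?thesis unfolding weight_def[abs_def] by measurable
qed

lemma bid_by_sets [measurable]: "{\<omega> \<in> space M. bid_by i t \<omega>} \<in> sets M"
  unfolding bid_by_def by (rule places_bid_sets) measurable

lemma mean_weight_measurable [measurable]: "mean_weight I w c \<in> borel_measurable borel"
  unfolding mean_weight_def[abs_def] by measurable

text \<open>
  Given the arrivals and the other bidders, the weight of a bidder may be replaced by its
  conditional mean, a function of his arrival time. On \<open>{K = n}\<close> this is done for one bidder
  after the other.
\<close>

lemma expectation_weights:
  assumes I: "finite I" and c: "\<And>k. k \<in> I \<Longrightarrow> c k \<le> T"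
    and W01: "\<And>i \<omega>. 0 \<le> weight I w c i \<omega> \<and> weight I w c i \<omega> \<le> 1"
    and g01: "\<And>x. 0 \<le> mean_weight I w c x \<and> mean_weight I w c x \<le> 1"
  shows "expectation (\<lambda>\<omega>. \<Prod>i<K \<omega>. weight I w c i \<omega>) = expectation (\<lambda>\<omega>. \<Prod>i<K \<omega>. mean_weight I w c (S i 0 \<omega>))"
proof -
  let ?W = "weight I w c" and ?g = "mean_weight I w c"
  have W_M [measurable]: "?W i \<in> borel_measurable M" for i
    by (rule weight_measurable) measurable
  have bounds: "\<bar>\<Prod>i\<in>J. ?g (S i 0 \<omega>)\<bar> \<le> 1" "\<bar>\<Prod>i\<in>J. ?W i \<omega>\<bar> \<le> 1" for J \<omega>
    using W01 g01 by (auto simp: abs_prod intro!: prod_le_1)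
  \<comment> \<open>A hybrid product: the first \<open>m\<close> bidders already have their
    conditional means, those from \<open>m\<close> to \<open>n - 1\<close> still have their
    weights.\<close>
  define U where "U n m \<omega> = (\<Prod>i<m. ?g (S i 0 \<omega>)) * (\<Prod>i\<in>{m..<n}. ?W i \<omega>)" for n m \<omega>
  have step: "expectation (\<lambda>\<omega>. U n (Suc m) \<omega> * of_bool (K \<omega> = n)) = expectation (\<lambda>\<omega>. U n m \<omega> * of_bool (K \<omega> = n))"
    if "m < n" for n m
  proof -
    interpret m: bidder T d \<alpha>\<^sub>2 \<alpha>\<^sub>3 M "{\<omega> \<in> space M. m < K \<omega>}" "outer_vars m" "outer_events m" "S m" "B m" "D m"
      by (rule bidder)
    \<comment> \<open>Everything except the factor of bidder \<open>m\<close>. It involves only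
      information outside his own choices, and since \<open>m < n\<close> it vanishes unless he
      exists.\<close>
    define Z where "Z \<omega> = of_bool (K \<omega> = n) * ((\<Prod>i<m. ?g (S i 0 \<omega>)) * (\<Prod>i\<in>{Suc m..<n}. ?W i \<omega>))" for \<omega>
    have Z: "Z \<in> borel_measurable m.FD"
    proof -
      have [measurable]: "S i 0 \<in> borel_measurable m.FD" for i
        unfolding m.FD_def by (rule generated_by_measurable[OF outer_events_Pow]) auto
      have K': "{\<omega> \<in> space m.FD. K \<omega> = n} \<in> sets m.FD"
        unfolding m.space_F unfolding m.FD_def by (rule generated_by_sets[OF outer_events_Pow]) auto
      have W': "?W i \<in> borel_measurable m.FD" if "i \<in> {Suc m..<n}" for i
      proof -
        have "i \<noteq> m" using that by simp
        note other = other_bidder[OF this]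
        show ?thesis
          unfolding m.FD_def
          by (intro weight_measurable generated_by_measurable[OF outer_events_Pow UnI1] generated_by_sets[OF outer_events_Pow] other)
      qed
      have "(\<lambda>\<omega>. \<Prod>i\<in>{Suc m..<n}. ?W i \<omega>) \<in> borel_measurable m.FD"
        by (intro borel_measurable_prod W')
      then show ?thesis unfolding Z_def[abs_def] using K' by measurable
    qed
    have Z01: "0 \<le> Z \<omega> \<and> Z \<omega> \<le> 1" for \<omega>
      using W01 g01 unfolding Z_def
      by (intro conjI mult_nonneg_nonneg prod_nonneg mult_le_one prod_le_1) auto
    have zero: "Z \<omega> = 0" if "\<omega> \<in> space M" "\<omega> \<notin> {\<omega> \<in> space M. m < K \<omega>}" for \<omega>
      using that \<open>m < n\<close> by (auto simp: Z_def)
    have Z_M [measurable]: "Z \<in> borel_measurable M"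
      using measurable_from_subalg[OF m.subalgebras(1) Z] .
    have int: "integrable M (\<lambda>\<omega>. Z \<omega> * f \<omega>)" if "f \<in> borel_measurable M" "\<And>\<omega>. \<omega> \<in> space M \<Longrightarrow> \<bar>f \<omega>\<bar> \<le> 1" for f
      by (rule m.integrable_times_bounded[where C = 1, OF Z_M that(1) _ that(2)]) (use Z01 in auto)
    have int_Z: "integrable M Z" using int[of "\<lambda>_. 1"] by simp
    have int_bid: "integrable M (\<lambda>\<omega>. Z \<omega> * of_bool (bid_by m t \<omega>))" for t
      by (rule int) auto
    have int_at: "integrable M (\<lambda>\<omega>. Z \<omega> * placed_at (c k) (S m 0 \<omega>))" if "k \<in> I" for k
      using placed_at_bounds[OF c[OF that]] by (intro int) auto
    have "expectation (\<lambda>\<omega>. Z \<omega> * ?W m \<omega>)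
        = expectation (\<lambda>\<omega>. Z \<omega> - (\<Sum>k\<in>I. w k * (Z \<omega> * of_bool (bid_by m (c k) \<omega>))))"
      by (intro Bochner_Integration.integral_cong) (simp_all add: weight_def right_diff_distrib sum_distrib_left mult_ac)
    also have "\<dots> = expectation Z - (\<Sum>k\<in>I. w k * expectation (\<lambda>\<omega>. Z \<omega> * of_bool (bid_by m (c k) \<omega>)))"
      using int_Z int_bid by simp
    also have "\<dots> = expectation Z - (\<Sum>k\<in>I. w k * expectation (\<lambda>\<omega>. Z \<omega> * placed_at (c k) (S m 0 \<omega>)))"
      unfolding bid_by_def using m.expectation_placed[OF Z _ zero c, of 1] Z01 by simp
    also have "\<dots> = expectation (\<lambda>\<omega>. Z \<omega> - (\<Sum>k\<in>I. w k * (Z \<omega> * placed_at (c k) (S m 0 \<omega>))))"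
      using int_Z int_at by simp
    also have "\<dots> = expectation (\<lambda>\<omega>. Z \<omega> * ?g (S m 0 \<omega>))"
      by (intro Bochner_Integration.integral_cong) (simp_all add: mean_weight_def right_diff_distrib sum_distrib_left mult_ac)
    also have "(\<lambda>\<omega>. Z \<omega> * ?g (S m 0 \<omega>)) = (\<lambda>\<omega>. U n (Suc m) \<omega> * of_bool (K \<omega> = n))"
      by (simp add: fun_eq_iff Z_def U_def mult_ac)
    also have "(\<lambda>\<omega>. Z \<omega> * ?W m \<omega>) = (\<lambda>\<omega>. U n m \<omega> * of_bool (K \<omega> = n))"
      using \<open>m < n\<close> by (simp add: fun_eq_iff Z_def U_def mult_ac prod.atLeast_Suc_lessThan)
    finally show ?thesis by simp
  qed
  have on_K: "expectation (\<lambda>\<omega>. (\<Prod>i<n. ?W i \<omega>) * of_bool (K \<omega> = n))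
      = expectation (\<lambda>\<omega>. (\<Prod>i<n. ?g (S i 0 \<omega>)) * of_bool (K \<omega> = n))" for n
  proof -
    have "expectation (\<lambda>\<omega>. U n m \<omega> * of_bool (K \<omega> = n)) = expectation (\<lambda>\<omega>. U n 0 \<omega> * of_bool (K \<omega> = n))"
      if "m \<le> n" for m
      using that by (induction m) (simp_all add: step)
    from this[of n] show ?thesis by (simp add: U_def atLeast0LessThan)
  qed
  have "(\<lambda>n. expectation (\<lambda>\<omega>. (\<Prod>i<n. ?W i \<omega>) * of_bool (K \<omega> = n))) sums expectation (\<lambda>\<omega>. \<Prod>i<K \<omega>. ?W i \<omega>)"
    using bounds(2) by (intro expectation_sums_nat[where C = 1]) auto
  moreover have "(\<lambda>n. expectation (\<lambda>\<omega>. (\<Prod>i<n. ?g (S i 0 \<omega>)) * of_bool (K \<omega> = n))) sums expectation (\<lambda>\<omega>. \<Prod>i<K \<omega>. ?g (S i 0 \<omega>))"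
    using bounds(1) by (intro expectation_sums_nat[where C = 1]) auto
  ultimately show ?thesis unfolding on_K by (rule sums_unique2)
qed

text \<open>\<open>1 - mean_weight I w c x\<close> is linear in the functions
  \<open>placed_at (c k)\<close>, whose integrals over \<open>[0, T]\<close> are
  \<open>T * placed (c k)\<close>. This evaluates the exponent in the generating functional of the
  arrivals.\<close>

lemma expectation_weights_eq_exp:
  assumes I: "finite I" and c: "\<And>k. k \<in> I \<Longrightarrow> 0 \<le> c k \<and> c k \<le> T"
    and W01: "\<And>i \<omega>. 0 \<le> weight I w c i \<omega> \<and> weight I w c i \<omega> \<le> 1"
    and g01: "\<And>x. 0 \<le> mean_weight I w c x \<and> mean_weight I w c x \<le> 1"
  shows "expectation (\<lambda>\<omega>. \<Prod>i<K \<omega>. weight I w c i \<omega>) = exp (- (\<Sum>k\<in>I. w k * (rate * T * placed (c k))))"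
proof -
  let ?g = "mean_weight I w c"
  have pp: "poisson_process M T (\<lambda>_. rate) (\<lambda>t \<omega>. card {i. i < K \<omega> \<and> S i 0 \<omega> \<le> t})"
    and range: "\<And>\<omega> i. \<omega> \<in> space M \<Longrightarrow> i < K \<omega> \<Longrightarrow> S i 0 \<omega> \<in> {0..T}"
    using auction unfolding auction_def by blast+
  have left: "(?g \<longlongrightarrow> ?g x) (at_left x)" if "x \<le> T" for x
    unfolding mean_weight_def[abs_def] using that c by (intro tendsto_intros placed_at_tendsto_left) auto
  have "expectation (\<lambda>\<omega>. \<Prod>i<K \<omega>. weight I w c i \<omega>) = expectation (\<lambda>\<omega>. \<Prod>i<K \<omega>. ?g (S i 0 \<omega>))"
    using c W01 g01 I by (intro expectation_weights) auto
  also have "\<dots> = exp (- (rate * (LINT x:{0<..T}|lborel. 1 - ?g x)))"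
    by (rule poisson_process_laplace_functional[OF T_pos K_measurable measurability(1) range pp mean_weight_measurable g01 left])
  also have "(LINT x:{0<..T}|lborel. 1 - ?g x) = (\<Sum>k\<in>I. w k * (T * placed (c k)))"
  proof -
    have "set_integrable lborel {0<..T} (\<lambda>x. 1 - ?g x)"
      unfolding set_integrable_def
    proof (rule Bochner_Integration.integrable_bound)
      show "integrable lborel (indicator {0<..T} :: real \<Rightarrow> real)"
        using T_pos by (intro integrable_real_indicator) auto
      show "AE x in lborel. norm (indicator {0<..T} x *\<^sub>R (1 - ?g x)) \<le> norm (indicator {0<..T} x :: real)"
        using g01 by (intro AE_I2) (auto simp: indicator_def)
    qed measurable
    then have "(LINT x:{0<..T}|lborel. 1 - ?g x) = integral {0<..T} (\<lambda>x. 1 - ?g x)"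
      by (rule set_borel_integral_eq_integral)
    also have "\<dots> = integral {0..T} (\<lambda>x. 1 - ?g x)"
      by (rule integral_spike_set; rule negligible_subset[of "{0}"]) auto
    also have "\<dots> = (\<Sum>k\<in>I. w k * (T * placed (c k)))"
      unfolding mean_weight_def using c I
      by (intro integral_unique) (auto intro!: has_integral_sum has_integral_mult_right placed_at_has_integral)
    finally show ?thesis .
  qed
  finally show ?thesis by (simp add: sum_distrib_left mult_ac)
qed

section \<open>The counting process of bids\<close>

definition bids :: "real \<Rightarrow> 'a \<Rightarrow> nat" where
  "bids t \<omega> = card {i. i < K \<omega> \<and> bid_by i t \<omega>}"

lemma finite_bidders: "finite {i. i < K \<omega> \<and> P i}"
  by (rule finite_subset[of _ "{..<K \<omega>}"]) auto

lemma bid_by_mono: "bid_by i s \<omega> \<Longrightarrow> s \<le> t \<Longrightarrow> bid_by i t \<omega>"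
  by (auto simp: bid_by_def)

lemma bids_mono: "s \<le> t \<Longrightarrow> bids s \<omega> \<le> bids t \<omega>"
  unfolding bids_def by (rule card_mono[OF finite_bidders]) (auto intro: bid_by_mono)

lemma bids_measurable [measurable]: "bids t \<in> measurable M (count_space UNIV)"
proof -
  have "(\<lambda>\<omega>. \<Sum>i<n. of_bool (bid_by i t \<omega>) :: nat) \<in> measurable M (count_space UNIV)" for n
    by measurable
  from measurable_compose_countable[OF this K_measurable]
  have "(\<lambda>\<omega>. \<Sum>i<K \<omega>. of_bool (bid_by i t \<omega>) :: nat) \<in> measurable M (count_space UNIV)" .
  moreover have "(\<Sum>i<K \<omega>. of_bool (bid_by i t \<omega>)) = bids t \<omega>" for \<omega>
    by (simp add: bids_def Int_def lessThan_def flip: of_nat_sum)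
  ultimately show ?thesis by simp
qed

text \<open>For a fixed outcome there are finitely many bidders, and the status of each is constant
  on some interval to the right of \<open>t\<close>, because a bid exactly at \<open>t\<close> is
  already counted.\<close>

lemma bids_right_continuous: "\<forall>\<^sub>F s in at_right t. bids s \<omega> = bids t \<omega>"
proof -
  have "\<forall>\<^sub>F s in at_right t. bid_by i s \<omega> = bid_by i t \<omega>" for i
  proof (cases "bid_time (S i) (B i) \<omega> \<le> t")
    case True
    have "\<forall>\<^sub>F s in at_right t. t < s" by (simp add: eventually_at_filter)
    then show ?thesis by eventually_elim (use True in \<open>auto simp: bid_by_def\<close>)
  next
    case False
    then have "\<forall>\<^sub>F s in at_right t. s < bid_time (S i) (B i) \<omega>"
      unfolding eventually_at_right_field by (intro exI[of _ "bid_time (S i) (B i) \<omega>"]) auto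
    then show ?thesis by eventually_elim (use False in \<open>auto simp: bid_by_def\<close>)
  qed
  then have "\<forall>\<^sub>F s in at_right t. \<forall>i\<in>{..<K \<omega>}. bid_by i s \<omega> = bid_by i t \<omega>"
    by (intro eventually_ball_finite) auto
  then show ?thesis
    unfolding bids_def by eventually_elim (auto intro!: arg_cong[where f = card])
qed

text \<open>At most one factor differs from 1, which makes the product affine in the indicators. It
  is applied to the single bid of a bidder and disjoint intervals.\<close>

lemma prod_at_most_one:
  fixes z :: "nat \<Rightarrow> real"
  assumes "\<And>j k. j < k \<Longrightarrow> k < n \<Longrightarrow> A k \<Longrightarrow> \<not> A j"
  shows "(\<Prod>k<n. if A k then z k else 1) = 1 - (\<Sum>k<n. (1 - z k) * of_bool (A k))"
  using assms
proof (induction n)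
  case (Suc n)
  have IH: "(\<Prod>k<n. if A k then z k else 1) = 1 - (\<Sum>k<n. (1 - z k) * of_bool (A k))"
    using Suc.prems by (intro Suc.IH) auto
  show ?case
  proof (cases "A n")
    case True
    then have "\<not> A k" if "k < n" for k using Suc.prems that by blast
    then have "(\<Sum>k<n. (1 - z k) * of_bool (A k)) = 0" by (intro sum.neutral) auto
    then show ?thesis using IH True by simp
  qed (use IH in simp)
qed simp

text \<open>Exchanging the products over intervals and over bidders turns the joint generating
  function of the increments into the expectation of a product of bidder weights, which is an
  exponential of a sum over the intervals and so factorizes.\<close>

lemma bids_increments:
  fixes t :: "nat \<Rightarrow> real"
  assumes t: "0 \<le> t 0" "\<And>k. k < n \<Longrightarrow> t k \<le> t (Suc k)" "t n \<le> T"
  shows "indep_vars (\<lambda>_. count_space UNIV) (\<lambda>k \<omega>. bids (t (Suc k)) \<omega> - bids (t k) \<omega>) {..<n}"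
    and "k < n \<Longrightarrow> prob {\<omega> \<in> space M. bids (t (Suc k)) \<omega> - bids (t k) \<omega> = j} =
      poisson_prob (rate * T * (placed (t (Suc k)) - placed (t k))) j"
proof -
  have t_mono: "t j \<le> t k" if "j \<le> k" "k \<le> n" for j k
    using that by (induction k rule: dec_induct) (use t(2) order_trans in \<open>auto simp: Suc_le_eq\<close>)
  have t_range: "0 \<le> t k" "t k \<le> T" if "k \<le> n" for k
    using t_mono[of 0 k] t_mono[of k n] t that by auto
  define m where "m k = rate * T * (placed (t (Suc k)) - placed (t k))" for k
  have pgf: "expectation (\<lambda>\<omega>. \<Prod>k<n. z k ^ (bids (t (Suc k)) \<omega> - bids (t k) \<omega>)) = (\<Prod>k<n. exp (- ((1 - z k) * m k)))"
    if z: "\<And>k. k \<in> {..<n} \<Longrightarrow> 0 \<le> z k \<and> z k \<le> 1" for z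
  proof -
    \<comment> \<open>A bid in interval \<open>k\<close> is a bid by \<open>t (Suc k)\<close> but
      not by \<open>t k\<close>. The Boolean tag marks the right and the left end point, which enter
      with opposite signs.\<close>
    define I where "I = {..<n} \<times> (UNIV :: bool set)"
    define w where "w = (\<lambda>(k, e). if e then 1 - z k else - (1 - z k))"
    define c where "c = (\<lambda>(k, e). if e then t (Suc k) else t k)"
    have sum_I: "(\<Sum>k\<in>I. w k * f (c k)) = (\<Sum>k<n. (1 - z k) * (f (t (Suc k)) - f (t k)))" for f :: "real \<Rightarrow> real"
    proof -
      have "(\<Sum>k\<in>I. w k * f (c k)) = (\<Sum>k<n. \<Sum>e\<in>UNIV. w (k, e) * f (c (k, e)))"
        unfolding I_def by (subst sum.cartesian_product) (simp add: case_prod_unfold)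
      then show ?thesis by (simp add: w_def c_def UNIV_bool algebra_simps)
    qed
    define A where "A i \<omega> k \<longleftrightarrow> bid_by i (t (Suc k)) \<omega> \<and> \<not> bid_by i (t k) \<omega>" for i \<omega> k
    have weight: "weight I w c i \<omega> = (\<Prod>k<n. if A i \<omega> k then z k else 1)" for i \<omega>
    proof -
      have "(\<Prod>k<n. if A i \<omega> k then z k else 1) = 1 - (\<Sum>k<n. (1 - z k) * of_bool (A i \<omega> k))"
      proof (rule prod_at_most_one)
        show "\<not> A i \<omega> j" if "j < k" "k < n" "A i \<omega> k" for j k
          using that bid_by_mono[of i "t (Suc j)" \<omega> "t k"] t_mono[of "Suc j" k] by (auto simp: A_def)
      qed
      also have "(\<Sum>k<n. (1 - z k) * of_bool (A i \<omega> k))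
          = (\<Sum>k<n. (1 - z k) * (of_bool (bid_by i (t (Suc k)) \<omega>) - of_bool (bid_by i (t k) \<omega>)))"
        using bid_by_mono[of i "t _" \<omega> "t (Suc _)"] t(2) by (intro sum.cong) (auto simp: A_def)
      finally show ?thesis
        unfolding weight_def using sum_I[of "\<lambda>s. of_bool (bid_by i s \<omega>)"] by simp
    qed
    have "expectation (\<lambda>\<omega>. \<Prod>k<n. z k ^ (bids (t (Suc k)) \<omega> - bids (t k) \<omega>))
        = expectation (\<lambda>\<omega>. \<Prod>i<K \<omega>. weight I w c i \<omega>)"
    proof (intro Bochner_Integration.integral_cong refl)
      fix \<omega>
      have "z k ^ (bids (t (Suc k)) \<omega> - bids (t k) \<omega>) = (\<Prod>i<K \<omega>. if A i \<omega> k then z k else 1)" if "k < n" for k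
      proof -
        have "{i. i < K \<omega> \<and> bid_by i (t k) \<omega>} \<subseteq> {i. i < K \<omega> \<and> bid_by i (t (Suc k)) \<omega>}"
          using t(2)[OF that] by (auto intro: bid_by_mono)
        then have "bids (t (Suc k)) \<omega> - bids (t k) \<omega>
            = card ({i. i < K \<omega> \<and> bid_by i (t (Suc k)) \<omega>} - {i. i < K \<omega> \<and> bid_by i (t k) \<omega>})"
          unfolding bids_def by (simp add: card_Diff_subset finite_bidders)
        also have "{i. i < K \<omega> \<and> bid_by i (t (Suc k)) \<omega>} - {i. i < K \<omega> \<and> bid_by i (t k) \<omega>}
            = {i \<in> {..<K \<omega>}. A i \<omega> k}"
          by (auto simp: A_def)
        finally show ?thesis by (simp add: prod.If_cases Int_def)
      qed
      then have "(\<Prod>k<n. z k ^ (bids (t (Suc k)) \<omega> - bids (t k) \<omega>))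
          = (\<Prod>k<n. \<Prod>i<K \<omega>. if A i \<omega> k then z k else 1)" by (intro prod.cong) auto
      also have "\<dots> = (\<Prod>i<K \<omega>. weight I w c i \<omega>)" unfolding weight by (rule prod.swap)
      finally show "(\<Prod>k<n. z k ^ (bids (t (Suc k)) \<omega> - bids (t k) \<omega>)) = (\<Prod>i<K \<omega>. weight I w c i \<omega>)" .
    qed
    also have "\<dots> = exp (- (\<Sum>k\<in>I. w k * (rate * T * placed (c k))))"
    proof (rule expectation_weights_eq_exp)
      show "finite I" by (simp add: I_def)
      show "0 \<le> c k \<and> c k \<le> T" if "k \<in> I" for k
        using that t_range by (auto simp: I_def c_def)
      show "0 \<le> weight I w c i \<omega> \<and> weight I w c i \<omega> \<le> 1" for i \<omega>
        unfolding weight using z by (intro conjI prod_nonneg prod_le_1) auto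
      show "0 \<le> mean_weight I w c x \<and> mean_weight I w c x \<le> 1" for x
      proof -
        \<comment> \<open>The increments of \<open>placed_at\<close> over the intervals are
          nonnegative and telescope, so their sum is at most 1.\<close>
        have inc: "0 \<le> placed_at (t (Suc k)) x - placed_at (t k) x" if "k < n" for k
          using placed_at_mono[of "t k" "t (Suc k)" x] t(2)[OF that] t_range[of "Suc k"] that by simp
        have "0 \<le> (\<Sum>k<n. (1 - z k) * (placed_at (t (Suc k)) x - placed_at (t k) x))"
          using z inc by (intro sum_nonneg mult_nonneg_nonneg) auto
        moreover have "(\<Sum>k<n. (1 - z k) * (placed_at (t (Suc k)) x - placed_at (t k) x))
            \<le> (\<Sum>k<n. placed_at (t (Suc k)) x - placed_at (t k) x)"
          using z inc by (intro sum_mono mult_left_le_one_le) auto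
        moreover have "(\<Sum>k<n. placed_at (t (Suc k)) x - placed_at (t k) x) = placed_at (t n) x - placed_at (t 0) x"
          by (rule sum_lessThan_telescope)
        moreover have "placed_at (t n) x \<le> 1" "0 \<le> placed_at (t 0) x"
          using placed_at_bounds t_range by auto
        ultimately show ?thesis
          unfolding mean_weight_def sum_I[of "\<lambda>s. placed_at s x"] by linarith
      qed
    qed
    also have "\<dots> = (\<Prod>k<n. exp (- ((1 - z k) * m k)))"
      unfolding sum_I[of "\<lambda>s. rate * T * placed s"]
      by (simp add: m_def exp_sum right_diff_distrib flip: sum_negf)
    finally show ?thesis .
  qed
  note indep = indep_poisson_if_pgf[of "{..<n}" "\<lambda>k \<omega>. bids (t (Suc k)) \<omega> - bids (t k) \<omega>" m]
  show "indep_vars (\<lambda>_. count_space UNIV) (\<lambda>k \<omega>. bids (t (Suc k)) \<omega> - bids (t k) \<omega>) {..<n}"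
    by (rule indep(1)) (use pgf in auto)
  show "prob {\<omega> \<in> space M. bids (t (Suc k)) \<omega> - bids (t k) \<omega> = j} = poisson_prob (rate * T * (placed (t (Suc k)) - placed (t k))) j"
    if "k < n"
    unfolding m_def[symmetric] by (rule indep(2)) (use pgf that in auto)
qed

text \<open>With coefficient 1 at the single time 0, the product of the weights is the indicator of
  \<open>bids 0 \<omega> = 0\<close>, and \<open>placed 0 = 0\<close> gives it the expectation
  \<open>exp 0 = 1\<close>.\<close>

lemma AE_bids_0: "AE \<omega> in M. bids 0 \<omega> = 0"
proof -
  let ?W = "weight {()} (\<lambda>_. 1) (\<lambda>_. 0)"
  have W: "?W i \<omega> = of_bool (\<not> bid_by i 0 \<omega>)" for i \<omega> by (simp add: weight_def)
  have "expectation (\<lambda>\<omega>. \<Prod>i<K \<omega>. ?W i \<omega>) = 1"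
    using T_pos placed_at_bounds[of 0]
    by (subst expectation_weights_eq_exp) (auto simp: W mean_weight_def)
  moreover have "(\<Prod>i<K \<omega>. ?W i \<omega>) = of_bool (bids 0 \<omega> = 0)" for \<omega>
  proof -
    have "bids 0 \<omega> = 0 \<longleftrightarrow> (\<forall>i<K \<omega>. \<not> bid_by i 0 \<omega>)"
      unfolding bids_def by (subst card_0_eq[OF finite_bidders]) auto
    then show ?thesis by (auto simp: W intro!: prod.neutral prod_zero)
  qed
  ultimately have "expectation (\<lambda>\<omega>. of_bool (bids 0 \<omega> = 0)) = (1::real)" by simp
  also have "expectation (\<lambda>\<omega>. of_bool (bids 0 \<omega> = 0) :: real) = expectation (indicator {\<omega> \<in> space M. bids 0 \<omega> = 0})"
    by (intro Bochner_Integration.integral_cong) (auto simp: indicator_def)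
  also have "\<dots> = prob {\<omega> \<in> space M. bids 0 \<omega> = 0}" by simp
  finally show ?thesis by (subst (asm) prob_eq_1) (auto elim: eventually_mono)
qed

lemma poisson_process_bids: "poisson_process M T (intensity (rate * \<alpha>\<^sub>2)) bids"
proof -
  have rate: "0 \<le> rate" using rate_pos by simp
  \<comment> \<open>The partition consists of the single interval \<open>(u, v]\<close>; its Poisson
    mean \<open>rate * T * (placed v - placed u)\<close> is the integral of the intensity.\<close>
  have law: "prob {\<omega> \<in> space M. bids v \<omega> - bids u \<omega> = n} =
      poisson_prob (LINT s:{u<..v}|lborel. intensity (rate * \<alpha>\<^sub>2) s) n"
    if uv: "0 \<le> u" "u \<le> v" "v \<le> T" for u v n
    using bids_increments(2)[of "\<lambda>k. if k = 0 then u else v" 1 0 n] uv intensity_integral(2)[OF rate uv] by simp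
  show ?thesis
    unfolding poisson_process_def
    using intensity_integral(1)[OF rate] AE_bids_0 bids_right_continuous bids_increments(1) law
      rate \<alpha>\<^sub>2_pos
    by (auto simp: intensity_nonneg poisson_prob_def intro!: mono_onI bids_mono)
qed

end

theorem mainTheorem3:
  fixes T rate d \<alpha>\<^sub>2 \<alpha>\<^sub>3 p :: real
    and M :: "'a measure" and S :: "nat \<Rightarrow> 'a \<Rightarrow> real" and B :: "nat \<Rightarrow> 'a set" and D :: "'a set"
    and M' :: "'b measure" and K :: "'b \<Rightarrow> nat"
    and S' :: "nat \<Rightarrow> nat \<Rightarrow> 'b \<Rightarrow> real" and B' :: "nat \<Rightarrow> nat \<Rightarrow> 'b set" and D' :: "nat \<Rightarrow> 'b set"
  assumes "0 < T" and "0 < rate" and "0 < d" and "d < T"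
    and "0 < \<alpha>\<^sub>2" and "\<alpha>\<^sub>2 \<le> \<alpha>\<^sub>3" and "\<alpha>\<^sub>3 \<le> 1"
    and p: "p = 1 - (d / T) powr \<alpha>\<^sub>2 * (1 - \<alpha>\<^sub>2 / \<alpha>\<^sub>3)"
  shows "(random_bidder T d \<alpha>\<^sub>2 \<alpha>\<^sub>3 M S B D \<longrightarrow>
            \<P>(\<omega> in M. places_bid T d S B D \<omega>) = p \<and>
            (\<forall>t. 0 \<le> t \<and> t < T - d \<longrightarrow>
               \<P>(\<omega> in M. bid_time S B \<omega> \<le> t \<bar> places_bid T d S B D \<omega>) =
                 1 / p * (1 - (1 - t / T) powr \<alpha>\<^sub>2)) \<and>
            (\<forall>t. T - d \<le> t \<and> t \<le> T \<longrightarrow>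
               \<P>(\<omega> in M. bid_time S B \<omega> \<le> t \<bar> places_bid T d S B D \<omega>) =
                 1 - 1 / p * (\<alpha>\<^sub>2 / \<alpha>\<^sub>3) * (d / T) powr \<alpha>\<^sub>2 * ((T - t) / d) powr \<alpha>\<^sub>3)) \<and>
         (auction T rate d \<alpha>\<^sub>2 \<alpha>\<^sub>3 M' K S' B' D' \<longrightarrow>
            (\<exists>c>0. poisson_process M' T
               (\<lambda>t. if t < T - d then c * (1 - t / T) powr (\<alpha>\<^sub>2 - 1)
                    else c * (d / T) powr (\<alpha>\<^sub>2 - \<alpha>\<^sub>3) * (1 - t / T) powr (\<alpha>\<^sub>3 - 1))
               (\<lambda>t \<omega>. card {i. i < K \<omega> \<and> places_bid T d (S' i) (B' i) (D' i) \<omega> \<and>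
                               bid_time (S' i) (B' i) \<omega> \<le> t})))"
proof (intro conjI impI)
  interpret bidding T d \<alpha>\<^sub>2 \<alpha>\<^sub>3
    using assms by unfold_locales
  have p_eq: "p = placed T" and p_pos: "0 < p"
    using p placed_T placed_T_pos by simp_all
  {
    assume rb: "random_bidder T d \<alpha>\<^sub>2 \<alpha>\<^sub>3 M S B D"
    note law = random_bidder_law[OF rb]
    show "\<P>(\<omega> in M. places_bid T d S B D \<omega>) = p"
      using law(2) p_eq by simp
    have cond: "\<P>(\<omega> in M. bid_time S B \<omega> \<le> t \<bar> places_bid T d S B D \<omega>) = placed t / p"
      if "0 \<le> t" "t \<le> T" for t
      using law(1)[of t] law(2) that by (simp add: cond_prob_def p_eq conj_commute)
    show "\<forall>t. 0 \<le> t \<and> t < T - d \<longrightarrow>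
        \<P>(\<omega> in M. bid_time S B \<omega> \<le> t \<bar> places_bid T d S B D \<omega>) = 1 / p * (1 - (1 - t / T) powr \<alpha>\<^sub>2)"
      using \<open>0 < d\<close> by (auto simp: cond placed_early)
    show "\<forall>t. T - d \<le> t \<and> t \<le> T \<longrightarrow>
        \<P>(\<omega> in M. bid_time S B \<omega> \<le> t \<bar> places_bid T d S B D \<omega>) =
          1 - 1 / p * (\<alpha>\<^sub>2 / \<alpha>\<^sub>3) * (d / T) powr \<alpha>\<^sub>2 * ((T - t) / d) powr \<alpha>\<^sub>3"
    proof (intro allI impI)
      fix t assume t: "T - d \<le> t \<and> t \<le> T"
      then have "\<P>(\<omega> in M. bid_time S B \<omega> \<le> t \<bar> places_bid T d S B D \<omega>)
          = (p - (\<alpha>\<^sub>2 / \<alpha>\<^sub>3) * (d / T) powr \<alpha>\<^sub>2 * ((T - t) / d) powr \<alpha>\<^sub>3) / p"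
        using cond[of t] placed_late[of t] p_eq \<open>d < T\<close> by simp
      then show "\<P>(\<omega> in M. bid_time S B \<omega> \<le> t \<bar> places_bid T d S B D \<omega>)
          = 1 - 1 / p * (\<alpha>\<^sub>2 / \<alpha>\<^sub>3) * (d / T) powr \<alpha>\<^sub>2 * ((T - t) / d) powr \<alpha>\<^sub>3"
        using p_pos by (simp add: diff_divide_distrib)
    qed
  }
  assume auction: "auction T rate d \<alpha>\<^sub>2 \<alpha>\<^sub>3 M' K S' B' D'"
  interpret prob_space M'
    using auction by (simp add: auction_def)
  interpret auction_process T d \<alpha>\<^sub>2 \<alpha>\<^sub>3 M' rate K S' B' D'
    using auction \<open>0 < rate\<close> by unfold_locales
  \<comment> \<open>The witness for \<open>c\<close> is the intensity at time 0, where the only bids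
    come from arrivals that bid at once, each with probability
    \<open>\<alpha>\<^sub>2\<close>.\<close>
  have "0 < rate * \<alpha>\<^sub>2" using assms by simp
  then show "\<exists>c>0. poisson_process M' T
      (\<lambda>t. if t < T - d then c * (1 - t / T) powr (\<alpha>\<^sub>2 - 1)
           else c * (d / T) powr (\<alpha>\<^sub>2 - \<alpha>\<^sub>3) * (1 - t / T) powr (\<alpha>\<^sub>3 - 1))
      (\<lambda>t \<omega>. card {i. i < K \<omega> \<and> places_bid T d (S' i) (B' i) (D' i) \<omega> \<and>
                      bid_time (S' i) (B' i) \<omega> \<le> t})"
    using poisson_process_bids
    unfolding intensity_def[abs_def] bids_def[abs_def] bid_by_def by blast
qed

end
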